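(* Let $F_0$ and $F_a$, the anomaly-score CDFs of the nominal and alien distributions, be continuous. Let $S_0$ and $S_m$ be nominal and mixture datasets containing $n$ i.i.d. samples from the nominal data distribution $D_0$ and the mixture data distribution $D_m$ respectively, where $D_m$ has true alien mixture probability $\alpha$. Let $\epsilon\in(0,1-q)$ and $\delta\in(0,1)$. Consider running the threshold-selection algorithm described in the context using an upper bound $\alpha'$ on the true $\alpha$. If the anomaly detector is admissible, i.e. $F_0(x)\ge F_m(x)$ for all $x\in\mathbb{R}$, and $$n>\frac12\,\ln\!\left(\frac{2}{1-\sqrt{1-\delta}}\right)\left(\frac1\epsilon\right)^2\left(\frac{2-\alpha'}{\alpha'}\right)^2,$$ then with probability at least $1-\delta$, the algorithm will return a threshold $\hat\tau_q$ that achieves an alien detection rate of at least $1-\eta$, where $\eta=q+\epsilon$.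
   Context: Setting (open category detection): there are an unknown nominal data distribution $D_0$, an unknown alien data distribution $D_a$, and a mixture distribution $D_m$ that generates a point from $D_a$ with probability $\alpha$ and from $D_0$ with probability $1-\alpha$; the upper bound $\alpha'$ satisfies $0<\alpha\le\alpha'\le1$. A fixed anomaly detector assigns a real-valued anomaly score to each data point (higher means more anomalous). $F_0,F_a,F_m$ denote the CDFs of the anomaly score under $D_0,D_a,D_m$, so $F_m=(1-\alpha)F_0+\alpha F_a$. The number $q\in(0,1)$ is an input to the algorithm (a target quantile level of $F_a$). The probability $1-\delta$ is over the random draws of $S_0$ and $S_m$. Threshold-selection algorithm run with $q$ and $\alpha'$: compute the anomaly scores $x_1,\dots,x_n$ of the points of $S_0$ and $y_1,\dots,y_n$ of the points of $S_m$; compute the empirical CDFs $\hat F_0(x)=\frac1n\#\{i:x_i\le x\}$ and $\hat F_m(x)=\frac1n\#\{i:y_i\le x\}$; set $$\hat F_a(x)=\frac{\hat F_m(x)-(1-\alpha')\hat F_0(x)}{\alpha'};$$ output $$\hat\tau_q=\max\{u\in S:\hat F_a(u)\le q\},\qquad S=\{x_1,\dots,x_n,y_1,\dots,y_n\}.$$ A point is labeled "alien" if its score is greater than the threshold. The alien detection rate of a threshold $\tau$ is the fraction of alien points (points drawn from $D_a$) labeled alien, i.e. $1-F_a(\tau)$.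
   Formalization: The set {u in S : F̂_a(u) ≤ q} can be empty, leaving the threshold undefined; the formal version then takes the threshold to be −∞ (every point is labeled alien, detection rate 1) and otherwise uses the stated maximum. *)

theory Defs
  imports "HOL-Probability.Probability"
begin

text \<open>
  A point is drawn from \<open>A\<close> with probability \<open>p\<close> and from \<open>B\<close> with probability \<open>1 - p\<close>.
\<close>

definition mixture :: "real \<Rightarrow> 'a measure \<Rightarrow> 'a measure \<Rightarrow> 'a measure" where
  "mixture p A B = measure_pmf (bernoulli_pmf p) \<bind> (\<lambda>alien. if alien then A else B)"

definition score_cdf :: "('a \<Rightarrow> real) \<Rightarrow> 'a measure \<Rightarrow> real \<Rightarrow> real" where
  "score_cdf score D = cdf (distr D borel score)"

definition admissible :: "('a \<Rightarrow> real) \<Rightarrow> 'a measure \<Rightarrow> 'a measure \<Rightarrow> bool" where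
  "admissible score D0 Dm \<longleftrightarrow> (\<forall>x. score_cdf score D0 x \<ge> score_cdf score Dm x)"

text \<open>
  Samples of size \<open>n\<close> are functions on \<open>nat\<close> of which only the values at \<open>i < n\<close> matter.
\<close>

definition empirical_cdf :: "nat \<Rightarrow> (nat \<Rightarrow> real) \<Rightarrow> real \<Rightarrow> real" where
  "empirical_cdf n x t = real (card {i. i < n \<and> x i \<le> t}) / real n"

definition alien_cdf_estimate ::
    "real \<Rightarrow> nat \<Rightarrow> (nat \<Rightarrow> real) \<Rightarrow> (nat \<Rightarrow> real) \<Rightarrow> real \<Rightarrow> real" where
  "alien_cdf_estimate \<alpha>' n x y t =
     (empirical_cdf n y t - (1 - \<alpha>') * empirical_cdf n x t) / \<alpha>'"

text \<open>
  No observed score need satisfy the constraint (for instance when \<open>\<alpha>' = 1\<close>, \<open>q < 1 / n\<close> and the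
  smallest score belongs to the mixture sample).  The maximum is taken in the extended reals, with
  the maximum of the empty set being \<open>-\<infinity>\<close>: every point is then labelled alien.
\<close>

definition threshold ::
    "real \<Rightarrow> real \<Rightarrow> nat \<Rightarrow> (nat \<Rightarrow> real) \<Rightarrow> (nat \<Rightarrow> real) \<Rightarrow> ereal" where
  "threshold q \<alpha>' n x y =
     (let C = {u \<in> x ` {..<n} \<union> y ` {..<n}. alien_cdf_estimate \<alpha>' n x y u \<le> q}
      in if C = {} then -\<infinity> else ereal (Max C))"

definition alien_detection_rate :: "('a \<Rightarrow> real) \<Rightarrow> 'a measure \<Rightarrow> ereal \<Rightarrow> real" where
  "alien_detection_rate score Da \<tau> = measure Da {z \<in> space Da. ereal (score z) > \<tau>}"

lemma
  assumes "prob_space A" "prob_space B" "sets A = sets B"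
  shows sets_mixture: "sets (mixture p A B) = sets B"
    and space_mixture: "space (mixture p A B) = space B"
    and prob_space_mixture: "prob_space (mixture p A B)"
proof -
  have k: "(\<lambda>alien. if alien then A else B) \<in> measure_pmf (bernoulli_pmf p) \<rightarrow>\<^sub>M prob_algebra B"
    using assms by (auto simp: space_prob_algebra)
  show sets: "sets (mixture p A B) = sets B"
    unfolding mixture_def by (rule sets_bind) (use assms in auto)
  show "space (mixture p A B) = space B"
    using sets by (rule sets_eq_imp_space_eq)
  show "prob_space (mixture p A B)"
    unfolding mixture_def
    by (rule prob_space_bind'[OF _ k])
       (simp add: space_prob_algebra prob_space_measure_pmf)
qed

lemma measure_mixture:
  assumes "prob_space A" "prob_space B" "sets A = sets B" "0 \<le> p" "p \<le> 1" "E \<in> sets B"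
  shows "measure (mixture p A B) E = p * measure A E + (1 - p) * measure B E"
proof -
  interpret A: prob_space A by fact
  interpret B: prob_space B by fact
  have k: "(\<lambda>alien. if alien then A else B) \<in> measure_pmf (bernoulli_pmf p) \<rightarrow>\<^sub>M subprob_algebra B"
    using assms by (auto simp: space_subprob_algebra prob_space_imp_subprob_space)
  have "emeasure (mixture p A B) E
      = (\<integral>\<^sup>+ b. emeasure (if b then A else B) E \<partial>measure_pmf (bernoulli_pmf p))"
    unfolding mixture_def by (rule emeasure_bind[OF _ k assms(6)]) simp
  also have "\<dots> = ennreal (p * measure A E + (1 - p) * measure B E)"
    using assms by (simp add: A.emeasure_eq_measure B.emeasure_eq_measure ennreal_mult'' mult.commute)
  finally show ?thesis
    using assms by (simp add: measure_def del: ennreal_plus)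
qed

lemma score_cdf_mixture:
  assumes "prob_space A" "prob_space B" "sets A = sets B" "0 \<le> p" "p \<le> 1"
    and "score \<in> borel_measurable B"
  shows "score_cdf score (mixture p A B) t
       = (1 - p) * score_cdf score B t + p * score_cdf score A t"
proof -
  have sp: "space A = space B"
    using assms(3) by (rule sets_eq_imp_space_eq)
  have mA: "score \<in> borel_measurable A"
    using assms(6) by (simp cong: measurable_cong_sets add: assms(3))
  have mM: "score \<in> borel_measurable (mixture p A B)"
    using assms(6) by (simp cong: measurable_cong_sets add: sets_mixture[OF assms(1-3)])
  have E: "score -` {..t} \<inter> space B \<in> sets B"
    using assms(6) by (rule measurable_sets) simp
  show ?thesis
    using measure_mixture[OF assms(1-5) E] assms(6) mA mM
    by (simp add: score_cdf_def cdf_def measure_distr space_mixture[OF assms(1-3)] sp)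
qed

lemma alien_detection_rate_real:
  assumes "prob_space Da" "score \<in> borel_measurable Da"
  shows "alien_detection_rate score Da (ereal t) = 1 - score_cdf score Da t"
proof -
  interpret prob_space Da by fact
  have "{z \<in> space Da. ereal (score z) > ereal t} = space Da - (score -` {..t} \<inter> space Da)"
    by auto
  moreover have "score -` {..t} \<inter> space Da \<in> events"
    using assms(2) by (rule measurable_sets) simp
  ultimately show ?thesis
    using assms(2)
    by (simp add: alien_detection_rate_def score_cdf_def cdf_def measure_distr prob_compl)
qed

end

theory Submission
  imports Defs
begin

text \<open>
  Put \<open>\<lambda> = \<epsilon> * \<alpha>' / (2 - \<alpha>')\<close>.  Admissibility gives \<open>F\<^sub>a \<le> (F\<^sub>m - (1 - \<alpha>') * F\<^sub>0) / \<alpha>'\<close>, so an observed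
  score \<open>u\<close> with estimate at most \<open>q\<close> but \<open>F\<^sub>a u > q + \<epsilon>\<close> forces the empirical CDF of the nominal sample
  to exceed \<open>F\<^sub>0\<close> by more than \<open>\<lambda>\<close> at \<open>u\<close>, or that of the mixture sample to fall short of \<open>F\<^sub>m\<close> by more
  than \<open>\<lambda>\<close>.  The two samples are independent, so it suffices that each of these one-sided deviations has
  probability at most \<open>2 * exp (- 2 * n * \<lambda>\<^sup>2)\<close>, which is below \<open>1 - sqrt (1 - \<delta>)\<close>.

  This one-sided Dvoretzky-Kiefer-Wolfowitz bound with the sharp exponent is obtained by changing the
  sampling law.  For crossings at low levels the points below are made more likely by the factor
  \<open>(1 + \<lambda>) / (1 - \<lambda>)\<close>; for crossings at high levels, scanned from the right, the points above are made
  less likely.  Up to the first crossing the likelihood ratio is a product of two powers, and at a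
  crossing it is at least \<open>exp (2 * n * \<lambda>\<^sup>2)\<close>.
\<close>

subsection \<open>Exponents of tilted crossings\<close>

text \<open>The polynomial starts the power series of \<open>2 * artanh z\<close>; the difference of
  the two sides has derivative \<open>2 * x ^ 4 / (1 - x ^ 2)\<close>.\<close>

lemma ln_ratio_ge_cubic: fixes z :: real assumes "0 \<le> z" "z < 1"
  shows "ln ((1 + z) / (1 - z)) \<ge> 2 * z + 2 * z ^ 3 / 3"
proof -
  have "ln (1 + z) - ln (1 - z) - (2 * z + 2 * z ^ 3 / 3) \<ge> ln (1 + 0) - ln (1 - 0) - (2 * 0
      + 2 * 0 ^ 3 / (3::real))"
  proof (rule DERIV_nonneg_imp_nondecreasing[OF assms(1)])
    fix x :: real assume x: "0 \<le> x" "x \<le> z"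
    have "1 / (1 + x) + 1 / (1 - x) - (2 + 2 * x ^ 2) = 2 * x ^ 4 / ((1 + x) * (1 - x))"
      using x assms by (simp add: divide_simps) algebra
    also have "\<dots> \<ge> 0" using x assms by simp
    finally have "0 \<le> 1 / (1 + x) + 1 / (1 - x) - (2 + 2 * x ^ 2)" .
    moreover have "((\<lambda>x. ln (1 + x) - ln (1 - x) - (2 * x + 2 * x ^ 3 / 3)) has_real_derivative
        1 / (1 + x) + 1 / (1 - x) - (2 + 2 * x ^ 2)) (at x)"
      using x assms by (auto intro!: derivative_eq_intros)
    ultimately show "\<exists>y. ((\<lambda>x. ln (1 + x) - ln (1 - x) - (2 * x
        + 2 * x ^ 3 / 3)) has_real_derivative y) (at x) \<and> 0 \<le> y"
      by blast
  qed
  then show ?thesis using assms by (simp add: ln_div)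
qed

text \<open>
  The right-hand side below is \<open>l * ln g\<close> plus a function that is concave in \<open>t\<close> and
  vanishes at \<open>t = 0\<close> and at \<open>t = (1
      - l) / 2\<close>; the tilt \<open>g\<close> is chosen to make both ends equal.
\<close>

lemma left_exponent_bound:
  fixes l t g :: real
  assumes l: "0 < l" "l < 1" and t: "0 \<le> t" "t \<le> (1 - l) / 2" and g: "g = (1 + l) / (1 - l)"
  shows "2 * l\<^sup>2 \<le> (t + l) * ln g + (1 - t - l) * ln ((1 - g * t) / (1 - t))"
proof -
  define s where "s = (1 - l) / 2"
  define f where "f x = - (x * ln g + (1 - x - l) * (ln (1 - g * x) - ln (1 - x)))" for x
  have g1: "1 < g" using l by (simp add: g field_simps)
  have gs: "g * s = (1 + l) / 2" using l by (simp add: g s_def field_simps)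
  have pos: "1 - g * x > 0" "1 - x > 0" if "x \<in> {0..s}" for x
  proof -
    have "g * x \<le> g * s" using that g1 by (intro mult_left_mono) auto
    then show "1 - g * x > 0" using gs l by simp
    show "1 - x > 0" using that l by (simp add: s_def)
  qed
  have conv: "convex_on {0..s} f"
  proof (rule f''_ge0_imp_convex)
    show "convex {0..s}" by simp
    fix x assume x: "x \<in> {0..s}"
    note px = pos[OF x]
    show "(f has_real_derivative
        - (ln g - (ln (1 - g * x) - ln (1 - x)) + (1 - x - l) * (- g / (1 - g * x) + 1 / (1 - x)))) (at x)"
      unfolding f_def using px
      by (auto intro!: derivative_eq_intros simp: divide_simps) algebra?
    show "((\<lambda>x. - (ln g - (ln (1 - g * x) - ln (1 - x)) + (1 - x - l) * (- g / (1 - g * x)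
        + 1 / (1 - x))))
       has_real_derivative - (2 * (g / (1 - g * x) - 1 / (1 - x)) + (1 - x - l) * (- (g / (1
           - g * x))\<^sup>2 + (1 / (1 - x))\<^sup>2))) (at x)"
      using px by (auto intro!: derivative_eq_intros simp: power2_eq_square)
    \<comment> \<open>For this tilt \<open>(1 - l) * (1 + g) = 2\<close>, so the constant term of
      the linear factor in the numerator vanishes and only a multiple of \<open>x\<close> of known
      sign remains.\<close>
    have gl: "(1 - l) * g = 1 + l" using l by (simp add: g)
    have "2 * (g / (1 - g * x) - 1 / (1 - x)) + (1 - x - l) * (- (g / (1 - g * x))\<^sup>2 + (1 / (1
        - x))\<^sup>2)
      = (g - 1) * (2 - (1 - l) * (1 + g) + x * (g - 1 - 2 * g * l)) / ((1 - g * x)\<^sup>2 * (1 - x)\<^sup>2)"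
      using px by (simp add: divide_simps) algebra
    also have "2 - (1 - l) * (1 + g) + x * (g - 1 - 2 * g * l) = - (x * l * (g - 1))"
      using gl by algebra
    finally have "2 * (g / (1 - g * x) - 1 / (1 - x)) + (1 - x - l) * (- (g / (1 - g * x))\<^sup>2
        + (1 / (1 - x))\<^sup>2)
      = - ((g - 1) * (x * l * (g - 1)) / ((1 - g * x)\<^sup>2 * (1 - x)\<^sup>2))" by simp
    moreover have "(g - 1) * (x * l * (g - 1)) / ((1 - g * x)\<^sup>2 * (1 - x)\<^sup>2) \<ge> 0"
      using x l g1 by (intro divide_nonneg_nonneg mult_nonneg_nonneg) auto
    ultimately show "0 \<le> - (2 * (g / (1 - g * x) - 1 / (1 - x)) + (1 - x - l) * (- (g / (1
        - g * x))\<^sup>2 + (1 / (1 - x))\<^sup>2))"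
      by simp
  qed
  have f0: "f 0 = 0" by (simp add: f_def)
  have fs: "f s = 0"
  proof -
    have "1 - g * s = (1 - l) / 2" "1 - s = (1 + l) / 2" and sl: "1 - s - l = s"
      using gs by (simp_all add: s_def field_simps)
    then have "ln (1 - g * s) - ln (1 - s) = ln ((1 - l) / 2) - ln ((1 + l) / 2)"
      by presburger
    also have "\<dots> = - ln g"
      using l by (simp add: g ln_div)
    finally show ?thesis unfolding f_def sl by simp
  qed
  have s0: "0 < s" using l by (simp add: s_def)
  have "f ((1 - t / s) *\<^sub>R 0 + (t / s) *\<^sub>R s) \<le> (1 - t / s) * f 0 + (t / s) * f s"
    using t s0 by (intro convex_onD[OF conv]) (auto simp: s_def field_simps)
  then have "f t \<le> 0" using f0 fs s0 by simp
  moreover have "(1 - t - l) * ln ((1 - g * t) / (1 - t)) = (1 - t - l) * (ln (1 - g * t) - ln (1 - t))"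
    using pos[of t] t by (simp add: ln_div s_def)
  ultimately have "l * ln g \<le> (t + l) * ln g + (1 - t - l) * ln ((1 - g * t) / (1 - t))"
    by (simp add: f_def algebra_simps)
  \<comment> \<open>The concave part contributes only something nonnegative; the target
    \<open>2 * l ^ 2\<close> comes entirely from \<open>l * ln g\<close>.\<close>
  moreover have "2 * l \<le> ln g"
  proof -
    have "0 \<le> 2 * l ^ 3 / 3" using l by simp
    then show ?thesis using ln_ratio_ge_cubic[of l] l unfolding g by linarith
  qed
  then have "l * (2 * l) \<le> l * ln g" using l by (intro mult_left_mono) auto
  ultimately show ?thesis by (simp add: power2_eq_square)
qed

section \<open>Polynomial inequalities\<close>

text \<open>
  Polynomial positivity on an interval is certified by expanding in Bernstein form.  The polynomials
  are the numerators of the derivatives estimated further below.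
\<close>

lemma tilt_end_poly_nonneg_left:
  fixes x :: real
  assumes "0 \<le> x" "x \<le> 1/3"
  shows "0 \<le> 632684 - 1582768 * x - 3119536 * x ^ 2 + 4980012 * x ^ 3 + 6548812 * x ^ 4
      + 3930920 * x ^ 5 - 2597000 * x ^ 6 - 1886500 * x ^ 7"
proof -
  have "(632684 - 1582768 * x - 3119536 * x ^ 2 + 4980012 * x ^ 3 + 6548812 * x ^ 4 + 3930920 * x ^ 5
      - 2597000 * x ^ 6 - 1886500 * x ^ 7) =
    632684 * (1 - 3 * x) ^ 7 + 11703596 * (x * (1 - 3 * x) ^ 6) + 87967916 * (x ^ 2 * (1
        - 3 * x) ^ 5) + 342399672 * (x ^ 3 * (1 - 3 * x) ^ 4) + 724515136 * (x ^ 4 * (1 - 3 * x) ^ 3)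
        + 795039488 * (x ^ 5 * (1 - 3 * x) ^ 2) + 393146368 * (x ^ 6 * (1 - 3 * x)) + 77694464 * (x ^ 7)"
    by algebra
  also have "\<dots> \<ge> 0"
    using assms by (intro add_nonneg_nonneg mult_nonneg_nonneg zero_le_power) auto
  finally show ?thesis by simp
qed

lemma tilt_end_poly_nonneg_right:
  fixes x :: real
  assumes "1/3 \<le> x" "x \<le> 1/2"
  shows "0 \<le> 632684 - 1582768 * x - 3119536 * x ^ 2 + 4980012 * x ^ 3 + 6548812 * x ^ 4
      + 3930920 * x ^ 5 - 2597000 * x ^ 6 - 1886500 * x ^ 7"
proof -
  \<comment> \<open>\<open>6 * x - 2\<close> and \<open>3 - 6 * x\<close> are the barycentric
    coordinates of \<open>x\<close> in the interval from 1/3 to 1/2; the factor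
    \<open>69984 = 2 ^ 5 * 3 ^ 7\<close> clears denominators.\<close>
  have "69984 * (632684 - 1582768 * x - 3119536 * x ^ 2 + 4980012 * x ^ 3 + 6548812 * x ^ 4
      + 3930920 * x ^ 5 - 2597000 * x ^ 6 - 1886500 * x ^ 7) =
    2486222848 * (3 - 6 * x) ^ 7 + 7234314240 * ((6 * x - 2) * (3 - 6 * x) ^ 6)
        + 4877641728 * ((6 * x - 2) ^ 2 * (3 - 6 * x) ^ 5) + 7861646592 * ((6 * x - 2) ^ 3 * (3
        - 6 * x) ^ 4) + 40680287856 * ((6 * x - 2) ^ 4 * (3 - 6 * x) ^ 3) + 67292383284 * ((6 * x
        - 2) ^ 5 * (3 - 6 * x) ^ 2) + 45594107982 * ((6 * x - 2) ^ 6 * (3 - 6 * x))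
        + 11249444673 * ((6 * x - 2) ^ 7)"
    by algebra
  also have "\<dots> \<ge> 0"
    using assms by (intro add_nonneg_nonneg mult_nonneg_nonneg zero_le_power) auto
  finally show ?thesis by simp
qed

text \<open>The degree 7 Bernstein expansion over the whole interval has a negative coefficient,
  that of \<open>x ^ 5 * (1 - 2 * x) ^ 2\<close>. After splitting at 1/3 both expansions have
  positive coefficients.\<close>

lemma tilt_end_poly_nonneg:
  fixes x :: real
  assumes "0 \<le> x" "x \<le> 1/2"
  shows "0 \<le> 632684 - 1582768 * x - 3119536 * x ^ 2 + 4980012 * x ^ 3 + 6548812 * x ^ 4
      + 3930920 * x ^ 5 - 2597000 * x ^ 6 - 1886500 * x ^ 7"
  using tilt_end_poly_nonneg_left[of x] tilt_end_poly_nonneg_right[of x] assms by (cases "x \<le> 1/3") auto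

lemma tilt_start_poly_nonneg:
  fixes x :: real
  assumes "0 \<le> x" "x \<le> 1/2"
  shows "0 \<le> 559682 + 1826108 * x - 9493204 * x ^ 2 + 13220544 * x ^ 3 - 8406662 * x ^ 4
      + 2681560 * x ^ 5 + 2361800 * x ^ 6 - 1886500 * x ^ 7"
proof -
  have "(559682 + 1826108 * x - 9493204 * x ^ 2 + 13220544 * x ^ 3 - 8406662 * x ^ 4
      + 2681560 * x ^ 5 + 2361800 * x ^ 6 - 1886500 * x ^ 7) =
    559682 * (1 - 2 * x) ^ 7 + 9661656 * (x * (1 - 2 * x) ^ 6) + 59433380 * (x ^ 2 * (1 - 2 * x) ^ 5)
        + 184565944 * (x ^ 3 * (1 - 2 * x) ^ 4) + 323228730 * (x ^ 4 * (1 - 2 * x) ^ 3)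
        + 324450548 * (x ^ 5 * (1 - 2 * x) ^ 2) + 177159456 * (x ^ 6 * (1 - 2 * x)) + 42566428 * (x ^ 7)"
    by algebra
  also have "\<dots> \<ge> 0"
    using assms by (intro add_nonneg_nonneg mult_nonneg_nonneg zero_le_power) auto
  finally show ?thesis by simp
qed

lemma end_gap_poly_nonneg_left:
  fixes x :: real
  assumes "0 \<le> x" "x \<le> 1/10"
  shows "0 \<le> 434313232 + 1713162268 * x - 6661798568 * x ^ 2 + 555787456 * x ^ 3
      + 4449267352 * x ^ 4 - 714494492 * x ^ 5 - 655179840 * x ^ 6 + 279417600 * x ^ 7"
proof -
  have "(434313232 + 1713162268 * x - 6661798568 * x ^ 2 + 555787456 * x ^ 3 + 4449267352 * x ^ 4
      - 714494492 * x ^ 5 - 655179840 * x ^ 6 + 279417600 * x ^ 7) =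
    434313232 * (1 - 10 * x) ^ 7 + 32115088508 * (x * (1 - 10 * x) ^ 6) + 1008185724712 * (x ^ 2 * (1
        - 10 * x) ^ 5) + 17438172381056 * (x ^ 3 * (1 - 10 * x) ^ 4) + 179637758757592 * (x ^ 4 * (1
        - 10 * x) ^ 3) + 1102880377719668 * (x ^ 5 * (1 - 10 * x) ^ 2)
        + 3738543041359920 * (x ^ 6 * (1 - 10 * x)) + 5400044151282000 * (x ^ 7)"
    by algebra
  also have "\<dots> \<ge> 0"
    using assms by (intro add_nonneg_nonneg mult_nonneg_nonneg zero_le_power) auto
  finally show ?thesis by simp
qed

lemma end_gap_poly_nonneg_right:
  fixes x :: real
  assumes "1/10 \<le> x" "x \<le> 1/2"
  shows "0 \<le> -6440 + 109136 * x - 35904 * x ^ 2 - 259280 * x ^ 3 - 107800 * x ^ 4"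
proof -
  have "12800 * (-6440 + 109136 * x - 35904 * x ^ 2 - 259280 * x ^ 3 - 107800 * x ^ 4) =
    192225 * (5 - 10 * x) ^ 4 + 2643812 * ((10 * x - 1) * (5 - 10 * x) ^ 3) + 5816838 * ((10 * x
        - 1) ^ 2 * (5 - 10 * x) ^ 2) + 3503460 * ((10 * x - 1) ^ 3 * (5 - 10 * x)) + 225 * ((10 * x - 1) ^ 4)"
    by algebra
  also have "\<dots> \<ge> 0"
    using assms by (intro add_nonneg_nonneg mult_nonneg_nonneg zero_le_power) auto
  finally show ?thesis by simp
qed

lemma large_gap_poly_nonneg:
  fixes x :: real
  assumes "1/2 \<le> x" "x \<le> 1"
  shows "0 \<le> - 2 * x ^ 2 + 2 * x ^ 3 + 6 * x ^ 4 + 6 * x ^ 5 - 4 * x ^ 6 + 4 * x ^ 7 - 4 * x ^ 8"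
proof -
  have "64 * (- 2 * x ^ 2 + 2 * x ^ 3 + 6 * x ^ 4 + 6 * x ^ 5 - 4 * x ^ 6 + 4 * x ^ 7 - 4 * x ^ 8) =
    17 * (2 - 2 * x) ^ 8 + 258 * ((2 * x - 1) * (2 - 2 * x) ^ 7) + 1564 * ((2 * x - 1) ^ 2 * (2
        - 2 * x) ^ 6) + 5084 * ((2 * x - 1) ^ 3 * (2 - 2 * x) ^ 5) + 9824 * ((2 * x - 1) ^ 4 * (2
        - 2 * x) ^ 4) + 11632 * ((2 * x - 1) ^ 5 * (2 - 2 * x) ^ 3) + 8256 * ((2 * x - 1) ^ 6 * (2
        - 2 * x) ^ 2) + 3200 * ((2 * x - 1) ^ 7 * (2 - 2 * x)) + 512 * ((2 * x - 1) ^ 8)"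
    by algebra
  also have "\<dots> \<ge> 0"
    using assms by (intro add_nonneg_nonneg mult_nonneg_nonneg zero_le_power) auto
  finally show ?thesis by simp
qed

section \<open>Exponents at high levels\<close>

text \<open>
  Dividing by \<open>1 - s + l\<close> before differentiating in \<open>s\<close> leaves a derivative without logarithms of \<open>s\<close>,
  whose sign is that of a quadratic.
\<close>

definition exponent_gap :: "real \<Rightarrow> real \<Rightarrow> real \<Rightarrow> real" where
  "exponent_gap l g s = ln (1 - g * s) - ln (1 - s) - (2 * l\<^sup>2 - (s - l) * ln g) / (1 - s + l)"

lemma exponent_gap_deriv:
  fixes l g s :: real
  assumes "0 < l" "0 < g" "g < 1" "0 \<le> s" "s < 1"
  shows "(exponent_gap l g has_real_derivative
     ((1 - g) * (1 - s + l)\<^sup>2 - (2 * l\<^sup>2 - ln g) * ((1 - g * s) * (1 - s))) / ((1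
         - g * s) * (1 - s) * (1 - s + l)\<^sup>2)) (at s)"
proof -
  have "g * s < 1" using assms by (metis less_eq_real_def mult_left_le_one_le order_le_less_trans)
  then have "(exponent_gap l g has_real_derivative
     - g / (1 - g * s) + 1 / (1 - s) - (- ln g * (1 - s + l) + (2 * l\<^sup>2 - (s - l) * ln g)) / (1
         - s + l)\<^sup>2) (at s)"
    unfolding exponent_gap_def[abs_def] using assms
    by (auto intro!: derivative_eq_intros simp: power2_eq_square)
  also have "- g / (1 - g * s) + 1 / (1 - s) - (- ln g * (1 - s + l) + (2 * l\<^sup>2 - (s
      - l) * ln g)) / (1 - s + l)\<^sup>2
     = ((1 - g) * (1 - s + l)\<^sup>2 - (2 * l\<^sup>2 - ln g) * ((1 - g * s) * (1 - s))) / ((1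
         - g * s) * (1 - s) * (1 - s + l)\<^sup>2)"
    using \<open>g * s < 1\<close> assms by (simp add: divide_simps) algebra
  finally show ?thesis .
qed

lemma exponent_of_gap_nonneg:
  fixes l g s :: real
  assumes "0 < l" "0 < g" "g < 1" "l \<le> s" "s < 1" "0 \<le> exponent_gap l g s"
  shows "2 * l\<^sup>2 \<le> (s - l) * ln g + (1 - s + l) * ln ((1 - g * s) / (1 - s))"
proof -
  have "g * s < 1" using assms by (metis less_eq_real_def mult_left_le_one_le order_le_less_trans order_trans)
  have "0 \<le> (1 - s + l) * exponent_gap l g s" using assms by simp
  also have "\<dots> = (1 - s + l) * (ln (1 - g * s) - ln (1 - s)) - (2 * l\<^sup>2 - (s - l) * ln g)"
    using assms by (simp add: exponent_gap_def right_diff_distrib[of _ _ "_ / _"])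
  finally show ?thesis using assms \<open>g * s < 1\<close> by (simp add: ln_div)
qed

text \<open>Clears denominators of a derivative while its factors \<open>w = 1 - x\<close>,
  \<open>q = 1 + x ^ 2\<close> and \<open>m = 1 + x\<close> are still opaque; the numerator is
  expanded in powers of \<open>x\<close> separately.\<close>

lemma large_gap_denominator:
  fixes a c q m w :: real
  assumes "w \<noteq> 0" "q \<noteq> 0" "m \<noteq> 0"
  shows "a / (w * q)\<^sup>2 - c - (1 / m + 1 / w) = (a * m - c * w\<^sup>2 * q\<^sup>2 * m - (w
      + m) * w * q\<^sup>2) / (w\<^sup>2 * q\<^sup>2 * m)"
  using assms by (simp add: divide_simps) algebra

lemma large_gap_numerator:
  fixes x :: real
  shows "(2 * ((1 - x) * (1 + x\<^sup>2)) - 2 * x * (- (1 + x\<^sup>2) + (1 - x) * (2 * x))) * (1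
      + x) - 4 * x * (1 - x)\<^sup>2 * (1 + x\<^sup>2)\<^sup>2 * (1 + x)
            - (1 - x + (1 + x)) * (1 - x) * (1 + x\<^sup>2)\<^sup>2 = - 2 * x ^ 2 + 2 * x ^ 3
                + 6 * x ^ 4 + 6 * x ^ 5 - 4 * x ^ 6 + 4 * x ^ 7 - 4 * x ^ 8"
  by (simp add: algebra_simps eval_nat_numeral)

text \<open>With this tilt the gap increases in \<open>s\<close>, so the left end
  \<open>s = l\<close> decides. There it equals
  \<open>ln ((1 + l ^ 2) / (1 - l ^ 2)) - 2 * l ^ 2\<close>, which is nonnegative by the series
  bound.\<close>

lemma exponent_gap_nonneg_large:
  fixes l s g :: real
  assumes l: "1/2 \<le> l" "l < 1" and s: "l \<le> s" "s \<le> (1 + l) / 2" and g: "g = (1 - l) / (1 + l)"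
  shows "0 \<le> exponent_gap l g s"
proof -
  have g01: "0 < g" "g < 1" using l by (auto simp: g field_simps)
  \<comment> \<open>This bound is exactly the condition for the derivative of the gap to be
    nonnegative at \<open>s = l\<close>; the rest of the range follows from it.\<close>
  have K: "2 * l\<^sup>2 - ln g \<le> 2 * l / ((1 - l) * (1 + l\<^sup>2))"
  proof -
    define f where "f x = 2 * x / ((1 - x) * (1 + x\<^sup>2)) - 2 * x\<^sup>2 - (ln (1 + x) - ln (1
        - x))" for x :: real
    have "f (1/2) \<le> f l"
    proof (rule DERIV_nonneg_imp_nondecreasing[OF l(1)])
      fix x :: real assume x: "1/2 \<le> x" "x \<le> l"
      have px: "1 + x\<^sup>2 > 0" "1 - x > 0" "1 + x > 0" using x l by (auto simp: add_pos_nonneg)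
      let ?d = "(2 * ((1 - x) * (1 + x\<^sup>2)) - 2 * x * (- (1 + x\<^sup>2) + (1
          - x) * (2 * x))) / ((1 - x) * (1 + x\<^sup>2))\<^sup>2 - 4 * x - (1 / (1 + x) + 1 / (1 - x))"
      have d: "(f has_real_derivative ?d) (at x)"
        unfolding f_def[abs_def] using px
        by (auto intro!: derivative_eq_intros simp: power2_eq_square)
      have "?d = (- 2 * x ^ 2 + 2 * x ^ 3 + 6 * x ^ 4 + 6 * x ^ 5 - 4 * x ^ 6 + 4 * x ^ 7
          - 4 * x ^ 8) / ((1 - x)\<^sup>2 * (1 + x\<^sup>2)\<^sup>2 * (1 + x))"
      proof -
        have "1 - x \<noteq> 0" "1 + x\<^sup>2 \<noteq> 0" "1 + x \<noteq> 0" using px by auto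
        note large_gap_denominator[OF this, of "2 * ((1 - x) * (1 + x\<^sup>2)) - 2 * x * (- (1
            + x\<^sup>2) + (1 - x) * (2 * x))" "4 * x"]
        also have "(2 * ((1 - x) * (1 + x\<^sup>2)) - 2 * x * (- (1 + x\<^sup>2) + (1
            - x) * (2 * x))) * (1 + x) - 4 * x * (1 - x)\<^sup>2 * (1 + x\<^sup>2)\<^sup>2 * (1 + x)
            - (1 - x + (1 + x)) * (1 - x) * (1 + x\<^sup>2)\<^sup>2 = - 2 * x ^ 2 + 2 * x ^ 3
                + 6 * x ^ 4 + 6 * x ^ 5 - 4 * x ^ 6 + 4 * x ^ 7 - 4 * x ^ 8"
          by (rule large_gap_numerator)
        finally show ?thesis .
      qed
      also have "\<dots> \<ge> 0"
        using large_gap_poly_nonneg[of x] x l px by (intro divide_nonneg_pos) auto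
      finally show "\<exists>y. (f has_real_derivative y) (at x) \<and> 0 \<le> y" using d by blast
    qed
    moreover have "0 \<le> f (1/2)"
    proof -
      \<comment> \<open>\<open>f (1/2)\<close> equals \<open>11/10 - ln 3\<close>. The quadratic
        Taylor bound for \<open>exp\<close> at \<open>11/10\<close> itself stays below 3, so it is
        applied at a sixteenth of the argument and raised to the power 16.\<close>
      have "(3::real) \<le> (1 + 11/160 + (11/160)\<^sup>2 / 2) ^ 16"
        by (simp add: power2_eq_square power_divide)
      also have "\<dots> \<le> exp (11/160) ^ 16"
        by (intro power_mono exp_lower_Taylor_quadratic) auto
      also have "\<dots> = exp (11/10 :: real)"
        by (simp flip: exp_of_nat_mult)
      finally have "ln (3::real) \<le> ln (exp (11/10))"
        by (subst ln_le_cancel_iff) auto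
      then show ?thesis by (simp add: f_def ln_div power2_eq_square)
    qed
    moreover have "ln g = ln (1 - l) - ln (1 + l)" using l by (simp add: g ln_div)
    ultimately show ?thesis by (simp add: f_def)
  qed
  have "exponent_gap l g l \<le> exponent_gap l g s"
  proof (rule DERIV_nonneg_imp_nondecreasing[OF s(1)])
    fix x :: real assume x: "l \<le> x" "x \<le> s"
    define v where "v = 1 - x"
    have v: "(1 - l) / 2 \<le> v" "v \<le> 1 - l" and xv: "1 - x = v" "x = 1 - v"
      using x s by (auto simp: v_def field_simps)
    have v0: "0 < v" using v l by simp
    have gx: "1 - g * x = (2 * l + (1 - l) * v) / (1 + l)" "1 - g = 2 * l / (1 + l)"
      using l by (auto simp: g xv field_simps)
    have pos: "2 * l + (1 - l) * v > 0" using l v0 by (simp add: add_pos_pos)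
    have "(2 * l\<^sup>2 - ln g) * (v * (2 * l + (1 - l) * v)) \<le> 2 * l / ((1 - l) * (1
        + l\<^sup>2)) * (v * (2 * l + (1 - l) * v))"
      using K v0 pos by (intro mult_right_mono) auto
    also have "\<dots> \<le> 2 * l / ((1 - l) * (1 + l\<^sup>2)) * ((1 - l) * (1 + l\<^sup>2) * (v
        + l)\<^sup>2)"
    proof (rule mult_left_mono)
      have "(1 - l) * v \<le> 1 * 1" using l v v0 by (intro mult_mono) auto
      then have "0 \<le> l\<^sup>2 * ((1 - l - v) * (1 + l\<^sup>2 - (1 - l) * v))"
        using v zero_le_power2[of l] by (intro mult_nonneg_nonneg) linarith+
      also have "\<dots> = (1 - l) * (1 + l\<^sup>2) * (v + l)\<^sup>2 - v * (2 * l + (1 - l) * v)"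
        by (simp add: algebra_simps power2_eq_square)
      finally show "v * (2 * l + (1 - l) * v) \<le> (1 - l) * (1 + l\<^sup>2) * (v + l)\<^sup>2" by simp
    qed (use l in simp)
    also have "\<dots> = 2 * l * (v + l)\<^sup>2"
    proof -
      have "1 + l\<^sup>2 \<noteq> 0" by (smt (verit) zero_le_power2)
      then show ?thesis using l by simp
    qed
    finally have "0 \<le> (2 * l * (v + l)\<^sup>2 - (2 * l\<^sup>2 - ln g) * (v * (2 * l + (1
        - l) * v))) / (1 + l)"
      using l by simp
    also have "\<dots> = (1 - g) * (1 - x + l)\<^sup>2 - (2 * l\<^sup>2 - ln g) * ((1 - g * x) * (1 - x))"
      unfolding gx xv(1) using l by (simp add: divide_simps)
    finally have num: "0 \<le> (1 - g) * (1 - x + l)\<^sup>2 - (2 * l\<^sup>2 - ln g) * ((1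
        - g * x) * (1 - x))" .
    have den: "(1 - g * x) * (1 - x) * (1 - x + l)\<^sup>2 \<ge> 0"
      unfolding gx xv(1) using pos v0 l by (intro mult_nonneg_nonneg divide_nonneg_nonneg) auto
    have "0 < l" "0 \<le> x" "x < 1" using x l xv v0 by auto
    from exponent_gap_deriv[OF this(1) g01 this(2,3)] divide_nonneg_nonneg[OF num den]
    show "\<exists>y. (exponent_gap l g has_real_derivative y) (at x) \<and> 0 \<le> y"
      by blast
  qed
  moreover have "0 \<le> exponent_gap l g l"
  proof -
    have "l\<^sup>2 < 1" using l by (simp add: power_less_one_iff)
    have "1 - g * l = (1 + l\<^sup>2) / (1 + l)" using l by (simp add: g power2_eq_square field_simps)
    moreover have "1 + l\<^sup>2 > 0" by (simp add: add_pos_nonneg)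
    ultimately have "ln (1 - g * l) - ln (1 - l) = ln (1 + l\<^sup>2) - (ln (1 + l) + ln (1 - l))"
      using l by (simp add: ln_div)
    also have "ln (1 + l) + ln (1 - l) = ln (1 - l\<^sup>2)"
      using l ln_mult[of "1 + l" "1 - l"] by (simp add: power2_eq_square algebra_simps)
    also have "ln (1 + l\<^sup>2) - ln (1 - l\<^sup>2) = ln ((1 + l\<^sup>2) / (1 - l\<^sup>2))"
      using \<open>1 + l\<^sup>2 > 0\<close> \<open>l\<^sup>2 < 1\<close> by (simp add: ln_div)
    finally have "ln (1 - g * l) - ln (1 - l) \<ge> 2 * l\<^sup>2"
      using ln_ratio_ge_cubic[of "l\<^sup>2"] \<open>l\<^sup>2 < 1\<close>
          by (smt (verit) zero_le_power2 zero_le_power divide_nonneg_pos mult_nonneg_nonneg)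
    then show ?thesis by (simp add: exponent_gap_def)
  qed
  ultimately show ?thesis by simp
qed

text \<open>
  For \<open>l \<le> 1 / 2\<close> the tilt is \<open>(23 - 35 * l) / (23
      + 11 * l)\<close>, which is \<open>1 - 2 * l + c * l\<^sup>2 + \<dots>\<close> with
  \<open>c\<close> slightly below 1.  Near \<open>l = 0\<close> the bound at the right end \<open>s
      = (1 + l) / 2\<close> needs
  \<open>2 - 2 / sqrt 3 < c\<close>,
      and the exponent gap is monotone in \<open>s\<close> on the whole range only if \<open>c\<close> is not
  much larger than that.  The next two bounds are the two extreme cases in \<open>s\<close> of that monotonicity.
\<close>

definition ln_tilt :: "real \<Rightarrow> real" where
  "ln_tilt l = ln (23 + 11 * l) - ln (23 - 35 * l)"

lemma ln_tilt_deriv: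
  assumes "0 \<le> x" "x \<le> 1/2"
  shows "(ln_tilt has_real_derivative 1058 / ((23 + 11 * x) * (23 - 35 * x))) (at x)"
proof -
  have "(ln_tilt has_real_derivative 11 / (23 + 11 * x) + 35 / (23 - 35 * x)) (at x)"
    unfolding ln_tilt_def[abs_def] using assms by (auto intro!: derivative_eq_intros)
  also have "11 / (23 + 11 * x) + 35 / (23 - 35 * x) = 1058 / ((23 + 11 * x) * (23 - 35 * x))"
    using assms by (simp add: divide_simps)
  finally show ?thesis .
qed

lemma end_quadratic_pos: "23 + 34 * x + 35 * x\<^sup>2 > (0::real)"
proof -
  have "35 * (23 + 34 * x + 35 * x\<^sup>2) = (35 * x + 17)\<^sup>2 + 516" by algebra
  then show ?thesis by (smt (verit) zero_le_power2)
qed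

lemma start_quadratic_pos: "23 - 12 * x + 35 * x\<^sup>2 > (0::real)"
proof -
  have "35 * (23 - 12 * x + 35 * x\<^sup>2) = (35 * x - 6)\<^sup>2 + 769" by algebra
  then show ?thesis by (smt (verit) zero_le_power2)
qed

lemma ln_tilt_ge_end:
  assumes "0 \<le> l" "l \<le> 1/2"
  shows "46 * l * (1 + l)\<^sup>2 / ((1 - l) * (23 + 34 * l + 35 * l\<^sup>2)) \<le> 2 * l\<^sup>2 + ln_tilt l"
proof -
  define f where "f x = 2 * x\<^sup>2 + ln_tilt x - 46 * x * (1 + x)\<^sup>2 / ((1 - x) * (23
      + 34 * x + 35 * x\<^sup>2))" for x
  have "f 0 \<le> f l"
  proof (rule DERIV_nonneg_imp_nondecreasing[OF assms(1)])
    fix x assume x: "0 \<le> x" "x \<le> l"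
    then have x': "0 \<le> x" "x \<le> 1/2" using assms by auto
    let ?d = "4 * x + 1058 / ((23 + 11 * x) * (23 - 35 * x))
       - ((46 * (1 + x)\<^sup>2 + 46 * x * (2 * (1 + x))) * ((1 - x) * (23 + 34 * x + 35 * x\<^sup>2))
          - 46 * x * (1 + x)\<^sup>2 * (- (23 + 34 * x + 35 * x\<^sup>2) + (1 - x) * (34
              + 70 * x))) / ((1 - x) * (23 + 34 * x + 35 * x\<^sup>2))\<^sup>2"
    have d: "(f has_real_derivative ?d) (at x)"
      unfolding f_def[abs_def] using x' end_quadratic_pos[of x]
      by (auto intro!: derivative_eq_intros ln_tilt_deriv simp: power2_eq_square) algebra
    \<comment> \<open>Both sides of the claim agree to second order at 0, so the derivative carries
      the factor \<open>x ^ 2\<close>; the cofactor in the numerator is a polynomial bounded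
      above.\<close>
    have "?d = x\<^sup>2 * (632684 - 1582768 * x - 3119536 * x ^ 2 + 4980012 * x ^ 3
        + 6548812 * x ^ 4 + 3930920 * x ^ 5 - 2597000 * x ^ 6 - 1886500 * x ^ 7) / (((23
        + 11 * x) * (23 - 35 * x)) * ((1 - x) * (23 + 34 * x + 35 * x\<^sup>2))\<^sup>2)"
      using x' end_quadratic_pos[of x] by (simp add: divide_simps) algebra
    also have "\<dots> \<ge> 0"
      using tilt_end_poly_nonneg[of x] x' by (intro divide_nonneg_nonneg mult_nonneg_nonneg) auto
    finally show "\<exists>y. (f has_real_derivative y) (at x) \<and> 0 \<le> y" using d by blast
  qed
  then show ?thesis by (simp add: f_def ln_tilt_def)
qed

lemma ln_tilt_ge_start:
  assumes "0 \<le> l" "l \<le> 1/2"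
  shows "46 * l / ((1 - l) * (23 - 12 * l + 35 * l\<^sup>2)) \<le> 2 * l\<^sup>2 + ln_tilt l"
proof -
  define f where "f x = 2 * x\<^sup>2 + ln_tilt x - 46 * x / ((1 - x) * (23 - 12 * x + 35 * x\<^sup>2))" for x
  have "f 0 \<le> f l"
  proof (rule DERIV_nonneg_imp_nondecreasing[OF assms(1)])
    fix x assume x: "0 \<le> x" "x \<le> l"
    then have x': "0 \<le> x" "x \<le> 1/2" using assms by auto
    let ?d = "4 * x + 1058 / ((23 + 11 * x) * (23 - 35 * x))
       - (46 * ((1 - x) * (23 - 12 * x + 35 * x\<^sup>2))
          - 46 * x * (- (23 - 12 * x + 35 * x\<^sup>2) + (1 - x) * (- 12 + 70 * x))) / ((1 - x) * (23
              - 12 * x + 35 * x\<^sup>2))\<^sup>2"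
    have d: "(f has_real_derivative ?d) (at x)"
      unfolding f_def[abs_def] using x' start_quadratic_pos[of x]
      by (auto intro!: derivative_eq_intros ln_tilt_deriv simp: power2_eq_square)
    have "?d = x\<^sup>2 * (559682 + 1826108 * x - 9493204 * x ^ 2 + 13220544 * x ^ 3
        - 8406662 * x ^ 4 + 2681560 * x ^ 5 + 2361800 * x ^ 6 - 1886500 * x ^ 7) / (((23
        + 11 * x) * (23 - 35 * x)) * ((1 - x) * (23 - 12 * x + 35 * x\<^sup>2))\<^sup>2)"
      using x' start_quadratic_pos[of x] by (simp add: divide_simps) algebra
    also have "\<dots> \<ge> 0"
      using tilt_start_poly_nonneg[of x] x' by (intro divide_nonneg_nonneg mult_nonneg_nonneg) auto
    finally show "\<exists>y. (f has_real_derivative y) (at x) \<and> 0 \<le> y" using d by blast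
  qed
  then show ?thesis by (simp add: f_def ln_tilt_def)
qed

text \<open>Again the denominators are cleared before the factors are expanded. Here
  \<open>n / Z\<close> is the argument at which the cubic series bound replaces
  \<open>ln_tilt\<close>; in the companion for the right part
  \<open>k * m ^ 2 / (o' * S) - d\<close> replaces it.\<close>

lemma end_gap_denominator_left:
  fixes S Q P o' m Z :: real
  assumes "S \<noteq> 0" "Q \<noteq> 0" "P \<noteq> 0" "o' \<noteq> 0" "m \<noteq> 0" "Z \<noteq> 0"
  shows "a / S - 11 / Q + 1 / o' - o' / m * (1058 / (Q * P)) - c / m\<^sup>2
      + 2 / m\<^sup>2 * (2 * (n / Z) + 2 * (n / Z) ^ 3 / 3)
    = (3 * (a * Q * P * o' * m\<^sup>2 * Z ^ 3 - 11 * S * P * o' * m\<^sup>2 * Z ^ 3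
        + S * Q * P * m\<^sup>2 * Z ^ 3
        - 1058 * S * o'\<^sup>2 * m * Z ^ 3 - c * S * Q * P * o' * Z ^ 3
            + 4 * n * S * Q * P * o' * Z\<^sup>2) + 4 * n ^ 3 * S * Q * P * o')
      / (3 * (S * Q * P * o' * m\<^sup>2 * Z ^ 3))"
  using assms by (simp add: divide_simps) algebra

lemma end_gap_denominator_right:
  fixes S Q P o' m :: real
  assumes "S \<noteq> 0" "Q \<noteq> 0" "P \<noteq> 0" "o' \<noteq> 0" "m \<noteq> 0"
  shows "a / S - 11 / Q + 1 / o' - o' / m * (1058 / (Q * P)) - c / m\<^sup>2
      + 2 / m\<^sup>2 * (k * m\<^sup>2 / (o' * S) - d)
    = (a * Q * P * o' * m\<^sup>2 - 11 * S * P * o' * m\<^sup>2 + S * Q * P * m\<^sup>2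
        - 1058 * S * o'\<^sup>2 * m - c * S * Q * P * o' + 2 * (k * m\<^sup>2 - d * o' * S) * Q * P)
      / (S * Q * P * o' * m\<^sup>2)"
  using assms by (simp add: divide_simps) algebra

text \<open>This is the exponent gap at \<open>s = (1 + l) / 2\<close>, viewed as a function of
  \<open>l\<close> that vanishes at 0. Its derivative still contains \<open>ln_tilt\<close>, but
  with a positive coefficient, so a lower bound for \<open>ln_tilt\<close> suffices. The bound
  \<open>ln_tilt_ge_end\<close> is too weak near 0 and the cubic series bound is too weak near 1/2,
  whence the split at 1/10.\<close>

lemma end_gap_nonneg:
  assumes l: "0 \<le> l" "l \<le> 1/2"
  shows "0 \<le> ln (23 + 34 * l + 35 * l\<^sup>2) - ln (23 + 11 * l) - ln (1 - l) - (4 * l\<^sup>2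
      + (1 - l) * ln_tilt l) / (1 + l)"
proof -
  define f where "f x = ln (23 + 34 * x + 35 * x\<^sup>2) - ln (23 + 11 * x) - ln (1 - x)
      - (4 * x\<^sup>2 + (1 - x) * ln_tilt x) / (1 + x)" for x
  have "f 0 \<le> f l"
  proof (rule DERIV_nonneg_imp_nondecreasing[OF l(1)])
    fix x assume x: "0 \<le> x" "x \<le> l"
    then have x': "0 \<le> x" "x \<le> 1/2" using assms by auto
    let ?S = "23 + 34 * x + 35 * x\<^sup>2" and ?Q = "23 + 11 * x" and ?P = "23 - 35 * x" and ?Z = "23 - 12 * x"
    let ?b = "(34 + 70 * x) / ?S - 11 / ?Q + 1 / (1 - x) - (1 - x) / (1 + x) * (1058 / (?Q * ?P))
        - (8 * x + 4 * x\<^sup>2) / (1 + x)\<^sup>2"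
    have "(f has_real_derivative (34 + 70 * x) / ?S - 11 / ?Q + 1 / (1 - x)
        - ((8 * x + (- ln_tilt x + (1 - x) * (1058 / (?Q * ?P)))) * (1 + x) - (4 * x\<^sup>2 + (1
            - x) * ln_tilt x)) / (1 + x)\<^sup>2) (at x)"
      unfolding f_def[abs_def] using x' end_quadratic_pos[of x]
      by (auto intro!: derivative_eq_intros ln_tilt_deriv simp: power2_eq_square)
    also have "(34 + 70 * x) / ?S - 11 / ?Q + 1 / (1 - x)
        - ((8 * x + (- ln_tilt x + (1 - x) * (1058 / (?Q * ?P)))) * (1 + x) - (4 * x\<^sup>2 + (1
            - x) * ln_tilt x)) / (1 + x)\<^sup>2
      = ?b + 2 / (1 + x)\<^sup>2 * ln_tilt x"
    proof -
      have *: "((8 * x + (- y + (1 - x) * r)) * (1 + x) - (4 * x\<^sup>2 + (1 - x) * y)) / (1 + x)\<^sup>2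
        = (1 - x) / (1 + x) * r + (8 * x + 4 * x\<^sup>2) / (1 + x)\<^sup>2 - 2 / (1 + x)\<^sup>2 * y" for y r
        using x' by (simp add: divide_simps) algebra
      show ?thesis unfolding * by simp
    qed
    finally have d: "(f has_real_derivative ?b + 2 / (1 + x)\<^sup>2 * ln_tilt x) (at x)" .
    have "0 \<le> ?b + 2 / (1 + x)\<^sup>2 * ln_tilt x"
    proof (cases "x \<le> 1/10")
      case True
      \<comment> \<open>Solves \<open>(1 + z) / (1 - z) = ?Q / ?P\<close>, whose logarithm is
        \<open>ln_tilt x\<close>.\<close>
      let ?z = "23 * x / ?Z"
      have z: "0 \<le> ?z" "?z < 1" using x' by (auto simp: field_simps)
      have "(1 + ?z) / (1 - ?z) = ?Q / ?P" using x' by (simp add: divide_simps)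
      then have "2 * ?z + 2 * ?z ^ 3 / 3 \<le> ln_tilt x"
        using ln_ratio_ge_cubic[OF z] x' by (simp add: ln_tilt_def ln_div)
      then have "2 / (1 + x)\<^sup>2 * (2 * ?z + 2 * ?z ^ 3 / 3) \<le> 2 / (1 + x)\<^sup>2 * ln_tilt x"
        by (intro mult_left_mono) auto
      moreover have "?b + 2 / (1 + x)\<^sup>2 * (2 * ?z + 2 * ?z ^ 3 / 3) =
          x ^ 3 * (434313232 + 1713162268 * x - 6661798568 * x ^ 2 + 555787456 * x ^ 3
              + 4449267352 * x ^ 4 - 714494492 * x ^ 5 - 655179840 * x ^ 6
              + 279417600 * x ^ 7) / (3 * (?S * ?Q * ?P * (1 - x) * (1 + x)\<^sup>2 * ?Z ^ 3))"
      proof -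
        have "?S \<noteq> 0" "?Q \<noteq> 0" "?P \<noteq> 0" "1 - x \<noteq> 0" "1
            + x \<noteq> 0" "?Z \<noteq> 0"
          using x' end_quadratic_pos[of x] by auto
        note end_gap_denominator_left[OF this, of "34 + 70 * x" "8 * x + 4 * x\<^sup>2" "23 * x"]
        also have "3 * ((34 + 70 * x) * ?Q * ?P * (1 - x) * (1 + x)\<^sup>2 * ?Z ^ 3
            - 11 * ?S * ?P * (1 - x) * (1 + x)\<^sup>2 * ?Z ^ 3
            + ?S * ?Q * ?P * (1 + x)\<^sup>2 * ?Z ^ 3 - 1058 * ?S * (1 - x)\<^sup>2 * (1 + x) * ?Z ^ 3
            - (8 * x + 4 * x\<^sup>2) * ?S * ?Q * ?P * (1 - x) * ?Z ^ 3
            + 4 * (23 * x) * ?S * ?Q * ?P * (1 - x) * ?Z\<^sup>2) + 4 * (23 * x) ^ 3 * ?S * ?Q * ?P * (1 - x)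
            = x ^ 3 * (434313232 + 1713162268 * x - 6661798568 * x ^ 2 + 555787456 * x ^ 3
                + 4449267352 * x ^ 4 - 714494492 * x ^ 5 - 655179840 * x ^ 6 + 279417600 * x ^ 7)" by algebra
        finally show ?thesis .
      qed
      moreover have "\<dots> \<ge> 0"
        using end_gap_poly_nonneg_left[of x] x' True end_quadratic_pos[of x]
            by (intro divide_nonneg_nonneg mult_nonneg_nonneg) auto
      ultimately show ?thesis by linarith
    next
      case False
      let ?r = "46 * x * (1 + x)\<^sup>2 / ((1 - x) * ?S) - 2 * x\<^sup>2"
      have "?r \<le> ln_tilt x"
        using ln_tilt_ge_end[OF x'] by simp
      then have "2 / (1 + x)\<^sup>2 * ?r \<le> 2 / (1 + x)\<^sup>2 * ln_tilt x"
        by (intro mult_left_mono) auto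
      moreover have "?b + 2 / (1 + x)\<^sup>2 * ?r = x ^ 3 * (-6440 + 109136 * x - 35904 * x ^ 2
          - 259280 * x ^ 3 - 107800 * x ^ 4) / (?S * ?Q * ?P * (1 - x) * (1 + x)\<^sup>2)"
      proof -
        have "?S \<noteq> 0" "?Q \<noteq> 0" "?P \<noteq> 0" "1 - x \<noteq> 0" "1 + x \<noteq> 0"
          using x' end_quadratic_pos[of x] by auto
        note end_gap_denominator_right[OF this, of "34 + 70 * x" "8 * x
            + 4 * x\<^sup>2" "46 * x" "2 * x\<^sup>2"]
        also have "(34 + 70 * x) * ?Q * ?P * (1 - x) * (1 + x)\<^sup>2 - 11 * ?S * ?P * (1 - x) * (1
            + x)\<^sup>2
            + ?S * ?Q * ?P * (1 + x)\<^sup>2 - 1058 * ?S * (1 - x)\<^sup>2 * (1 + x)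
            - (8 * x + 4 * x\<^sup>2) * ?S * ?Q * ?P * (1 - x)
            + 2 * (46 * x * (1 + x)\<^sup>2 - 2 * x\<^sup>2 * (1 - x) * ?S) * ?Q * ?P
            = x ^ 3 * (-6440 + 109136 * x - 35904 * x ^ 2 - 259280 * x ^ 3 - 107800 * x ^ 4)" by algebra
        finally show ?thesis .
      qed
      moreover have "\<dots> \<ge> 0"
        using end_gap_poly_nonneg_right[of x] x' False end_quadratic_pos[of x]
            by (intro divide_nonneg_nonneg mult_nonneg_nonneg) auto
      ultimately show ?thesis by linarith
    qed
    then show "\<exists>y. (f has_real_derivative y) (at x) \<and> 0 \<le> y" using d by blast
  qed
  then show ?thesis by (simp add: f_def ln_tilt_def)
qed

lemma affine_le_zero:
  fixes p r a b v :: real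
  assumes "a \<le> v" "v \<le> b" "p + r * a \<le> 0" "p + r * b \<le> 0"
  shows "p + r * v \<le> 0"
proof (cases "r \<ge> 0")
  case True
  then have "r * v \<le> r * b" using assms by (intro mult_left_mono) auto
  then show ?thesis using assms by linarith
next
  case False
  then have "r * v \<le> r * a" using assms by (intro mult_left_mono_neg) auto
  then show ?thesis using assms by linarith
qed

text \<open>In contrast to large \<open>l\<close>, the gap decreases in \<open>s\<close>, so the
  right end decides and \<open>end_gap_nonneg\<close> applies. The sign of the derivative is that of
  a quadratic in \<open>v = 1 - s\<close>, whose values at the two ends are controlled by
  \<open>ln_tilt_ge_end\<close> and \<open>ln_tilt_ge_start\<close>.\<close>

lemma exponent_gap_nonneg_small:
  fixes l s g :: real
  assumes l: "0 < l" "l \<le> 1/2" and s: "l \<le> s" "s \<le> (1 + l) / 2"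
    and g: "g = (23 - 35 * l) / (23 + 11 * l)"
  shows "0 \<le> exponent_gap l g s"
proof -
  have g01: "0 < g" "g < 1" using l by (auto simp: g field_simps)
  have lng: "ln g = - ln_tilt l" using l by (simp add: g ln_tilt_def ln_div)
  define K where "K = 2 * l\<^sup>2 - ln g"
  have K1: "46 * l * (1 + l)\<^sup>2 \<le> K * ((1 - l) * (23 + 34 * l + 35 * l\<^sup>2))"
    using ln_tilt_ge_end[of l] l end_quadratic_pos[of l] by (simp add: K_def lng pos_divide_le_eq)
  have K2: "46 * l \<le> K * ((1 - l) * (23 - 12 * l + 35 * l\<^sup>2))"
    using ln_tilt_ge_start[of l] l start_quadratic_pos[of l] by (simp add: K_def lng pos_divide_le_eq)
  have "exponent_gap l g ((1 + l) / 2) \<le> exponent_gap l g s"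
  proof (rule DERIV_nonpos_imp_nonincreasing[OF s(2)])
    fix x :: real assume x: "s \<le> x" "x \<le> (1 + l) / 2"
    define v where "v = 1 - x"
    have v: "(1 - l) / 2 \<le> v" "v \<le> 1 - l" and xv: "1 - x = v" "x = 1 - v"
      using x s by (auto simp: v_def field_simps)
    have v0: "0 < v" using v l by simp
    have gx: "1 - g * x = (46 * l + (23 - 35 * l) * v) / (23 + 11 * l)" "1 - g = 46 * l / (23 + 11 * l)"
      using l by (auto simp: g xv field_simps)
    have pos: "46 * l + (23 - 35 * l) * v > 0" using l v0 by (simp add: add_pos_pos)
    \<comment> \<open>Adding \<open>46 * l * c\<close> times the product
      \<open>(2 * v - (1 - l)) * (1 - l - v)\<close>, nonnegative between the ends and zero at them,
      leaves the end values unchanged. This \<open>c\<close> cancels the constant term, so the sum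
      is \<open>(p + r * v) * v\<close>, and the affine factor need only be checked at the
      ends.\<close>
    define c where "c = l\<^sup>2 / (1 - l)\<^sup>2"
    have ca: "c * (1 - l)\<^sup>2 = l\<^sup>2" using l by (simp add: c_def)
    define p where "p = 46 * l * (2 * l + 3 * c * (1 - l)) - 46 * K * l"
    define r where "r = 46 * l * (1 - 2 * c) - K * (23 - 35 * l)"
    have nonpos: "x \<le> 0" if "x * y \<le> 0" "0 < y" for x y :: real
      using that by (simp add: mult_le_0_iff)
    have "p + r * v \<le> 0"
    proof (rule affine_le_zero[OF v])
      have "(2 * p + r * (1 - l)) * (1 - l) = 46 * l * (4 * l * (1 - l) + 4 * (c * (1 - l)\<^sup>2)
          + (1 - l)\<^sup>2) - K * ((1 - l) * (92 * l + (23 - 35 * l) * (1 - l)))"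
        unfolding p_def r_def by algebra
      also have "\<dots> = 46 * l * (1 + l)\<^sup>2 - K * ((1 - l) * (23 + 34 * l + 35 * l\<^sup>2)) "
        unfolding ca by algebra
      also have "\<dots> \<le> 0" using K1 by linarith
      finally have "2 * p + r * (1 - l) \<le> 0"
        by (rule nonpos) (use l in simp)
      then show "p + r * ((1 - l) / 2) \<le> 0" by simp
      have "(p + r * (1 - l)) * (1 - l) = 46 * l * (2 * l * (1 - l) + c * (1 - l)\<^sup>2 + (1
          - l)\<^sup>2) - K * ((1 - l) * (46 * l + (23 - 35 * l) * (1 - l)))"
        unfolding p_def r_def by algebra
      also have "\<dots> = 46 * l - K * ((1 - l) * (23 - 12 * l + 35 * l\<^sup>2))"
        unfolding ca by algebra
      also have "\<dots> \<le> 0" using K2 by linarith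
      finally show "p + r * (1 - l) \<le> 0"
        by (rule nonpos) (use l in simp)
    qed
    then have "(p + r * v) * v \<le> 0" using v0 by (simp add: mult_le_0_iff)
    moreover have "0 \<le> 46 * l * c * ((2 * v - (1 - l)) * (1 - l - v))"
      using l v by (intro mult_nonneg_nonneg) (auto simp: c_def)
    moreover have "46 * l * (l\<^sup>2 - c * (1 - l)\<^sup>2) = 0" unfolding ca by simp
    moreover have "a - b + d \<le> 0" if "a \<le> 0" "0 \<le> b" "d = 0" for a b d :: real
      using that by simp
    ultimately have "(p + r * v) * v - 46 * l * c * ((2 * v - (1 - l)) * (1 - l - v))
        + 46 * l * (l\<^sup>2 - c * (1 - l)\<^sup>2) \<le> 0"
      by blast
    also have "(p + r * v) * v - 46 * l * c * ((2 * v - (1 - l)) * (1 - l - v)) + 46 * l * (l\<^sup>2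
        - c * (1 - l)\<^sup>2)
       = 46 * l * (v + l)\<^sup>2 - K * (v * (46 * l + (23 - 35 * l) * v))"
      unfolding p_def r_def by algebra
    finally have le0: "46 * l * (v + l)\<^sup>2 - K * (v * (46 * l + (23 - 35 * l) * v)) \<le> 0" .
    have "(1 - g) * (1 - x + l)\<^sup>2 - K * ((1 - g * x) * (1 - x))
       = (46 * l * (v + l)\<^sup>2 - K * (v * (46 * l + (23 - 35 * l) * v))) / (23 + 11 * l)"
      unfolding gx xv(1) using l by (simp add: divide_simps)
    also have "\<dots> \<le> 0"
      by (rule divide_nonpos_pos[OF le0]) (use l in simp)
    finally have num: "(1 - g) * (1 - x + l)\<^sup>2 - K * ((1 - g * x) * (1 - x)) \<le> 0" .
    have den: "(1 - g * x) * (1 - x) * (1 - x + l)\<^sup>2 \<ge> 0"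
      unfolding gx xv(1) using pos v0 l by (intro mult_nonneg_nonneg divide_nonneg_nonneg) auto
    have "0 \<le> x" "x < 1" using x s l xv v0 by auto
    from exponent_gap_deriv[OF l(1) g01 this] divide_nonpos_nonneg[OF num den]
    show "\<exists>y. (exponent_gap l g has_real_derivative y) (at x) \<and> y \<le> 0"
      unfolding K_def by blast
  qed
  moreover have "0 \<le> exponent_gap l g ((1 + l) / 2)"
  proof -
    have "1 - g * ((1 + l) / 2) = (23 + 34 * l + 35 * l\<^sup>2) / (2 * (23 + 11 * l))"
      using l by (simp add: g divide_simps) algebra
    then have "ln (1 - g * ((1 + l) / 2)) = ln ((23 + 34 * l + 35 * l\<^sup>2) / (2 * (23 + 11 * l)))"
      by (rule arg_cong)
    also have "\<dots> = ln (23 + 34 * l + 35 * l\<^sup>2) - (ln 2 + ln (23 + 11 * l))"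
      using l end_quadratic_pos[of l] by (subst ln_div; (subst ln_mult)?) auto
    finally have 1: "ln (1 - g * ((1 + l) / 2)) = ln (23 + 34 * l + 35 * l\<^sup>2) - (ln 2 + ln (23
        + 11 * l))" .
    have 2: "1 - (1 + l) / 2 = (1 - l) / 2" "(1 + l) / 2 - l = (1 - l) / 2" "(1 - l) / 2 + l = (1 + l) / 2"
      by (simp_all add: field_simps)
    have 3: "ln ((1 - l) / 2) = ln (1 - l) - ln 2" using l by (simp add: ln_div)
    have 4: "(2 * l\<^sup>2 - (1 - l) / 2 * - ln_tilt l) / ((1 + l) / 2) = (4 * l\<^sup>2 + (1
        - l) * ln_tilt l) / (1 + l)"
      using l by (simp add: divide_simps) algebra
    show ?thesis
      unfolding exponent_gap_def 1 2 3 lng 4 using end_gap_nonneg[of l] l by linarith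
  qed
  ultimately show ?thesis by simp
qed

text \<open>In the application \<open>s\<close> is the probability of an upper half-line and
  \<open>s - l\<close> the fraction of points in it at a crossing. Only the existence of a tilt is
  stated because its formula changes at \<open>l = 1 / 2\<close>.\<close>

lemma right_exponent_bound:
  fixes l :: real
  assumes l: "0 < l" "l < 1"
  shows "\<exists>g. 0 < g \<and> g < 1 \<and> (\<forall>s. l \<le> s \<and> s \<le> (1
      + l) / 2 \<longrightarrow>
     2 * l\<^sup>2 \<le> (s - l) * ln g + (1 - s + l) * ln ((1 - g * s) / (1 - s)))"
proof (cases "l \<le> 1/2")
  case True
  let ?g = "(23 - 35 * l) / (23 + 11 * l)"
  have "0 < ?g" "?g < 1" using l True by (auto simp: field_simps)
  then show ?thesis
    using exponent_gap_nonneg_small[OF l(1) True] exponent_of_gap_nonneg[OF l(1), of ?g] l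
        by (intro exI[of _ ?g]) auto
next
  case False
  let ?g = "(1 - l) / (1 + l)"
  have "0 < ?g" "?g < 1" using l by (auto simp: field_simps)
  then show ?thesis
    using exponent_gap_nonneg_large[of l] False exponent_of_gap_nonneg[OF l(1), of ?g] l
        by (intro exI[of _ ?g]) auto
qed

subsection \<open>Change of measure\<close>

text \<open>By \<open>closed\<close>, \<open>E\<close> is a finite disjoint union of products of
  cells of \<open>\<phi>\<close>. On each such product both measures factor, so \<open>ratio\<close>
  compares them there, and the comparisons add up.\<close>

lemma PiM_measure_mono_of_cells:
  fixes \<mu> \<nu> :: "'a measure" and \<phi> :: "'a \<Rightarrow> 'c" and E :: "('i \<Rightarrow> 'a) set"
  assumes \<mu>: "prob_space \<mu>" and \<nu>: "prob_space \<nu>" and sets: "sets \<nu>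
      = sets \<mu>" and I: "finite I"
    and \<phi>: "\<And>d. \<phi> -` {d} \<inter> space \<mu> \<in> sets \<mu>"
        and D: "finite (\<phi> ` space \<mu>)"
    and E: "E \<subseteq> (\<Pi>\<^sub>E i\<in>I. space \<mu>)"
    and closed: "\<And>z z'. z \<in> E
        \<Longrightarrow> z' \<in> (\<Pi>\<^sub>E i\<in>I. space \<mu>)
        \<Longrightarrow> (\<And>i. i \<in> I \<Longrightarrow> \<phi> (z' i)
        = \<phi> (z i)) \<Longrightarrow> z' \<in> E"
    and ratio: "\<And>z. z \<in> E
        \<Longrightarrow> L * (\<Prod>i\<in>I. measure \<mu> (\<phi> -` {\<phi> (z i)} \<inter> space \<mu>))
                   \<le> (\<Prod>i\<in>I. measure \<nu> (\<phi> -` {\<phi> (z i)} \<inter> space \<mu>))"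
  shows "E \<in> sets (Pi\<^sub>M I (\<lambda>_. \<mu>))"
    and "L * measure (Pi\<^sub>M I (\<lambda>_. \<mu>)) E \<le> measure (Pi\<^sub>M I (\<lambda>_. \<nu>)) E"
proof -
  interpret \<mu>: prob_space \<mu> by fact
  interpret \<nu>: prob_space \<nu> by fact
  interpret P\<mu>: finite_product_prob_space "\<lambda>_. \<mu>" I by unfold_locales fact
  interpret P\<nu>: finite_product_prob_space "\<lambda>_. \<nu>" I by unfold_locales fact
  have \<phi>': "\<phi> -` {d} \<inter> space \<mu> \<in> sets \<nu>" for d using \<phi> sets by simp
  define cell where "cell d
      = (\<Pi>\<^sub>E i\<in>I. \<phi> -` {d i} \<inter> space \<mu>)" for d :: "'i \<Rightarrow> 'c"
  \<comment> \<open>Restricting the labels to \<open>I\<close> makes distinct labels differ at some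
    index in \<open>I\<close>, which gives disjoint cells.\<close>
  define Ds where "Ds = (\<lambda>z. \<lambda>i\<in>I. \<phi> (z i)) ` E"
  have "Ds \<subseteq> (\<Pi>\<^sub>E i\<in>I. \<phi> ` space \<mu>)" using E by (fastforce simp: Ds_def)
  then have fin: "finite Ds" using finite_PiE[OF I] D by (metis (mono_tags, lifting) finite_subset)
  have EU: "E = (\<Union>d\<in>Ds. cell d)"
  proof (intro set_eqI iffI)
    fix z assume z: "z \<in> E"
    then have "z \<in> cell (\<lambda>i\<in>I. \<phi> (z i))" using E by (auto simp: cell_def PiE_iff)
    then show "z \<in> (\<Union>d\<in>Ds. cell d)" using z by (auto simp: Ds_def)
  next
    fix z assume "z \<in> (\<Union>d\<in>Ds. cell d)"
    then obtain y where y: "y \<in> E" "z \<in> cell (\<lambda>i\<in>I. \<phi> (y i))" by (auto simp: Ds_def)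
    then show "z \<in> E" by (intro closed[OF y(1)]) (auto simp: cell_def PiE_iff)
  qed
  have disj: "disjoint_family_on cell Ds"
  proof (unfold disjoint_family_on_def, intro ballI impI)
    fix d e assume de: "d \<in> Ds" "e \<in> Ds" "d \<noteq> e"
    have "d \<in> extensional I" "e \<in> extensional I" using de by (auto simp: Ds_def)
    then have "\<exists>i\<in>I. d i \<noteq> e i" using de(3) by (metis extensionalityI)
    then show "cell d \<inter> cell e = {}" by (auto simp: cell_def PiE_iff)
  qed
  have cell_sets: "cell d \<in> sets (Pi\<^sub>M I (\<lambda>_. \<mu>))" "cell d \<in> sets (Pi\<^sub>M I (\<lambda>_. \<nu>))" for d
    unfolding cell_def using \<phi> \<phi>' I by (auto intro!: sets_PiM_I_finite)
  then show "E \<in> sets (Pi\<^sub>M I (\<lambda>_. \<mu>))" unfolding EU using fin by auto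
  have "L * measure (Pi\<^sub>M I (\<lambda>_. \<mu>)) E
      = (\<Sum>d\<in>Ds. L * measure (Pi\<^sub>M I (\<lambda>_. \<mu>)) (cell d))"
    unfolding EU sum_distrib_left[symmetric]
    by (subst P\<mu>.finite_measure_finite_Union) (use fin disj cell_sets in auto)
  also have "\<dots> \<le> (\<Sum>d\<in>Ds. measure (Pi\<^sub>M I (\<lambda>_. \<nu>)) (cell d))"
  proof (rule sum_mono)
    fix d assume "d \<in> Ds"
    then obtain z where z: "z \<in> E" "d = (\<lambda>i\<in>I. \<phi> (z i))" by (auto simp: Ds_def)
    have "measure (Pi\<^sub>M I (\<lambda>_. \<mu>)) (cell d)
        = (\<Prod>i\<in>I. measure \<mu> (\<phi> -` {\<phi> (z i)} \<inter> space \<mu>))"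
      unfolding cell_def by (subst P\<mu>.prob_times) (use \<phi> z(2) in \<open>auto intro!: prod.cong\<close>)
    moreover have "measure (Pi\<^sub>M I (\<lambda>_. \<nu>)) (cell d)
        = (\<Prod>i\<in>I. measure \<nu> (\<phi> -` {\<phi> (z i)} \<inter> space \<mu>))"
      unfolding cell_def by (subst P\<nu>.prob_times)
          (use \<phi>' z(2) in \<open>auto intro!: prod.cong\<close>)
    ultimately show "L * measure (Pi\<^sub>M I (\<lambda>_. \<mu>)) (cell d)
        \<le> measure (Pi\<^sub>M I (\<lambda>_. \<nu>)) (cell d)"
      using ratio[OF z(1)] by simp
  qed
  also have "\<dots> = measure (Pi\<^sub>M I (\<lambda>_. \<nu>)) E"
    unfolding EU by (subst P\<nu>.finite_measure_finite_Union) (use fin disj cell_sets in auto)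
  finally show "L * measure (Pi\<^sub>M I (\<lambda>_. \<mu>)) E
      \<le> measure (Pi\<^sub>M I (\<lambda>_. \<nu>)) E" .
qed

text \<open>The density is \<open>\<rho>\<close> on \<open>A\<close> and constant on the complement,
  the constant being forced by total mass 1; it is nonnegative because
  \<open>\<rho> * prob A\<close> is at most 1.\<close>

lemma (in prob_space) exists_tilted_measure:
  assumes A: "A \<in> events" "prob A < 1" and \<rho>: "0 \<le> \<rho>" "\<rho> * prob A \<le> 1"
  shows "\<exists>\<nu>. prob_space \<nu> \<and> sets \<nu>
      = events \<and> (\<forall>B\<in>events. B \<subseteq> A \<longrightarrow> measure \<nu> B
      = \<rho> * prob B)"
proof -
  define h where "h = (1 - \<rho> * prob A) / (1 - prob A)"
  have h: "0 \<le> h" using assms by (simp add: h_def)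
  define f where "f x = (if x \<in> A then \<rho> else h)" for x
  have [measurable]: "A \<in> events" by fact
  have f: "(\<lambda>x. ennreal (f x)) \<in> borel_measurable M" unfolding f_def by measurable
  define \<nu> where "\<nu> = density M (\<lambda>x. ennreal (f x))"
  have em: "emeasure \<nu> B = ennreal (\<rho> * prob (B \<inter> A) + h * prob (B
      - A))" if B: "B \<in> events" for B
  proof -
    have [measurable]: "B \<in> events" by fact
    have "emeasure \<nu> B = (\<integral>\<^sup>+ x. ennreal \<rho> * indicator (B \<inter> A) x
        + ennreal h * indicator (B - A) x \<partial>M)"
      unfolding \<nu>_def using B f
      by (subst emeasure_density) (auto intro!: nn_integral_cong simp: f_def indicator_def)
    also have "\<dots> = ennreal \<rho> * emeasure M (B \<inter> A) + ennreal h * emeasure M (B - A)"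
      by (subst nn_integral_add) (auto simp: nn_integral_cmult)
    also have "\<dots> = ennreal (\<rho> * prob (B \<inter> A) + h * prob (B - A))"
      using \<rho> h by (simp add: emeasure_eq_measure ennreal_mult)
    finally show ?thesis .
  qed
  have "prob (space M - A) = 1 - prob A" using A by (simp add: prob_compl)
  then have "\<rho> * prob (space M \<inter> A) + h * prob (space M - A) = 1"
    using A by (simp add: h_def)
  then have "prob_space \<nu>"
    using em[of "space M"] by (intro prob_spaceI) (simp add: \<nu>_def)
  moreover have "measure \<nu> B = \<rho> * prob B" if "B \<in> events" "B \<subseteq> A" for B
  proof -
    have "prob (B \<inter> A) = prob B" "prob (B - A) = 0"
      using that by (simp_all add: Int_absorb2 Diff_eq_empty_iff[THEN iffD2])
    then have "emeasure \<nu> B = ennreal (\<rho> * prob B)" using em[OF that(1)] by simp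
    then show ?thesis using \<rho> by (intro measure_eq_emeasure_eq_ennreal) simp_all
  qed
  ultimately show ?thesis by (auto simp: \<nu>_def)
qed

lemma prod_if_card:
  fixes a b :: real
  assumes "finite I"
  shows "(\<Prod>i\<in>I. (if P i then a else b) * g i) = a ^ card {i\<in>I. P i} * b ^ (card I
      - card {i\<in>I. P i}) * (\<Prod>i\<in>I. g i)"
proof -
  have "I \<inter> {i. P i} = {i\<in>I. P i}" "I \<inter> - {i. P i} = I - {i\<in>I. P i}" by auto
  moreover have "card (I - {i\<in>I. P i}) = card I - card {i\<in>I. P i}"
    using assms by (intro card_Diff_subset) auto
  ultimately show ?thesis
    using assms by (simp add: prod.distrib prod.If_cases)
qed

text \<open>
  A maximal inequality by change of measure.  Under the tilted law, with density \<open>\<rho>\<close> on the largest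
  set of the chain, the event that the first crossing happens at \<open>k\<close> has at least \<open>L\<close> times its
  original probability: this event depends on the points only through the cells
  \<open>{j. j \<le> k \<and> x \<in> A j}\<close>, and on cells the likelihood ratio is explicit.
\<close>

lemma chain_crossing_bound:
  fixes \<mu> :: "'a measure" and A :: "nat \<Rightarrow> 'a set" and W :: "nat \<Rightarrow> nat set"
  assumes \<mu>: "prob_space \<mu>"
    and A: "\<And>k. k \<le> m \<Longrightarrow> A k \<in> sets \<mu>" and mono: "\<And>j k. j
        \<le> k \<Longrightarrow> k \<le> m \<Longrightarrow> A j \<subseteq> A k"
    and A1: "measure \<mu> (A m) < 1" and \<rho>: "0 \<le> \<rho>" "\<rho> * measure \<mu> (A m) \<le> 1"
    and L: "\<And>k c. k \<le> m \<Longrightarrow> c \<le> n \<Longrightarrow> c \<in> W k \<Longrightarrow>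
        L \<le> \<rho> ^ c * ((1 - \<rho> * measure \<mu> (A k)) / (1 - measure \<mu> (A k))) ^ (n - c)"
  defines "N \<equiv> Pi\<^sub>M {..<n} (\<lambda>_. \<mu>)"
  shows "{z \<in> space N. \<exists>k\<le>m. card {i. i
      < n \<and> z i \<in> A k} \<in> W k} \<in> sets N" (is "?E \<in> _")
    and "L * measure N {z \<in> space N. \<exists>k\<le>m. card {i. i
        < n \<and> z i \<in> A k} \<in> W k} \<le> 1"
proof -
  interpret prob_space \<mu> by fact
  obtain \<nu> where \<nu>: "prob_space \<nu>" "sets \<nu> = events"
      "\<And>B. B \<in> events \<Longrightarrow> B \<subseteq> A m \<Longrightarrow> measure \<nu> B
          = \<rho> * prob B"
    using exists_tilted_measure[OF A A1 \<rho>] by auto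
  interpret \<nu>: prob_space \<nu> by fact
  have sp: "space \<nu> = space \<mu>" using \<nu>(2) by (rule sets_eq_imp_space_eq)
  define cnt where "cnt k z = card {i. i < n \<and> z i \<in> A k}" for k and z :: "nat \<Rightarrow> 'a"
  define E where "E k = {z \<in> space N. cnt k z \<in> W k \<and> (\<forall>j<k. cnt j z \<notin> W j)}" for k
  define \<phi> where "\<phi> k x = {j. j \<le> k \<and> x \<in> A j}" for k x
  have space: "space N = (\<Pi>\<^sub>E i\<in>{..<n}. space \<mu>)" by (simp add: N_def space_PiM)
  have EU: "?E = (\<Union>k\<in>{..m}. E k)"
  proof (intro set_eqI iffI)
    fix z assume z: "z \<in> ?E"
    define k where "k = (LEAST k. cnt k z \<in> W k)"
    obtain k' where k': "k' \<le> m" "cnt k' z \<in> W k'" using z by (auto simp: cnt_def)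
    have "cnt k z \<in> W k" unfolding k_def by (rule LeastI) fact
    moreover have "k \<le> k'" unfolding k_def by (rule Least_le) fact
    moreover have "cnt j z \<notin> W j" if "j < k" for j using not_less_Least that unfolding k_def by blast
    ultimately show "z \<in> (\<Union>k\<in>{..m}. E k)" using z k' by (auto simp: E_def)
  next
    fix z assume "z \<in> (\<Union>k\<in>{..m}. E k)"
    then obtain k where "k \<le> m" "z \<in> space N" "cnt k z \<in> W k" unfolding E_def by blast
    then show "z \<in> ?E" unfolding cnt_def by blast
  qed
  have disj: "disjoint_family_on E {..m}"
    unfolding disjoint_family_on_def E_def by (auto dest: linorder_neqE_nat)
  have step: "E k \<in> sets N" "L * measure N (E k)
      \<le> measure (Pi\<^sub>M {..<n} (\<lambda>_. \<nu>)) (E k)" if k: "k \<le> m" for k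
  proof -
    have Ak: "A j \<in> events" if "j \<le> k" for j using A that k by simp
    have \<phi>m: "\<phi> k -` {d} \<inter> space \<mu> \<in> events" for d
    proof -
      have "\<phi> k -` {d} \<inter> space \<mu>
          = {x \<in> space \<mu>. d \<subseteq> {..k} \<and> (\<forall>j\<in>{..k}. (x \<in> A j)
          = (j \<in> d))}"
        unfolding \<phi>_def by blast
      also have "\<dots> \<in> events" using Ak by measurable
      finally show ?thesis .
    qed
    have fin: "finite (\<phi> k ` space \<mu>)"
      by (rule finite_subset[of _ "Pow {..k}"]) (auto simp: \<phi>_def)
    have cnt_\<phi>: "cnt j z = card {i. i < n \<and> j \<in> \<phi> k (z i)}" if "j \<le> k" for j z
      using that by (auto simp: cnt_def \<phi>_def)
    have closed: "z' \<in> E k" if "z \<in> E k" "z' \<in> (\<Pi>\<^sub>E i\<in>{..<n}. space \<mu>)" "\<And>i. i \<in> {..<n} \<Longrightarrow> \<phi> k (z' i) = \<phi> k (z i)" for z z'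
    proof -
      have "cnt j z' = cnt j z" if "j \<le> k" for j
        unfolding cnt_\<phi>[OF that] using \<open>\<And>i. i \<in> {..<n}
            \<Longrightarrow> \<phi> k (z' i) = \<phi> k (z i)\<close>
        by (auto intro!: arg_cong[where f=card])
      then show ?thesis using that(1,2) by (auto simp: E_def space)
    qed
    define r where "r = (1 - \<rho> * prob (A k)) / (1 - prob (A k))"
    have pA: "prob (A k) \<le> prob (A m)" using mono[of k m] k A by (intro finite_measure_mono) auto
    \<comment> \<open>The cell of a point in \<open>A k\<close> lies inside \<open>A m\<close>,
      where the density is \<open>\<rho>\<close>. As the sets form a chain, all other points share
      the empty label, so their cell is the complement of \<open>A k\<close> and its tilted mass is
      known as well.\<close>
    have cellA: "measure \<nu> (\<phi> k -` {\<phi> k x} \<inter> space \<mu>)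
        = (if x \<in> A k then \<rho> else r) * prob (\<phi> k -` {\<phi> k x} \<inter> space \<mu>)" for x
    proof (cases "x \<in> A k")
      case True
      then have "k \<in> \<phi> k x" by (simp add: \<phi>_def)
      then have "\<phi> k -` {\<phi> k x} \<inter> space \<mu> \<subseteq> A k" by (auto simp: \<phi>_def)
      also have "A k \<subseteq> A m" using mono k by simp
      finally show ?thesis using True \<nu>(3)[OF \<phi>m] by simp
    next
      case False
      then have e: "\<phi> k y = {}" if "y \<notin> A k" for y using mono[of _ k] k that
          by (auto simp: \<phi>_def)
      have "\<phi> k -` {\<phi> k x} \<inter> space \<mu> = space \<mu> - A k"
        unfolding e[OF False] using e by (auto simp: \<phi>_def)
      moreover have "measure \<nu> (space \<mu> - A k) = 1 - \<rho> * prob (A k)"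
        using \<nu>.prob_compl[of "A k"] \<nu>(2,3) Ak[of k] mono[of k m] k sp by simp
      moreover have "prob (space \<mu> - A k) = 1 - prob (A k)" using Ak[of k] by (simp add: prob_compl)
      ultimately show ?thesis using False pA A1 by (simp add: r_def)
    qed
    have ratio: "L * (\<Prod>i\<in>{..<n}. prob (\<phi> k -` {\<phi> k (z i)} \<inter> space \<mu>))
        \<le> (\<Prod>i\<in>{..<n}. measure \<nu> (\<phi> k -` {\<phi> k (z i)} \<inter> space \<mu>))" if z: "z \<in> E k" for z
    proof -
      have c: "cnt k z = card {i\<in>{..<n}. z i \<in> A k}" by (simp add: cnt_def)
      have "cnt k z \<le> n" unfolding c using card_mono[of "{..<n}" "{i\<in>{..<n}. z i \<in> A k}"] by auto
      then have "L \<le> \<rho> ^ cnt k z * r ^ (n - cnt k z)"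
        using L[OF k, of "cnt k z"] z by (simp add: E_def r_def)
      then show ?thesis
        unfolding cellA prod_if_card[OF finite_lessThan] c[symmetric] card_lessThan
        by (intro mult_right_mono prod_nonneg) auto
    qed
    have "E k \<subseteq> (\<Pi>\<^sub>E i\<in>{..<n}. space \<mu>)" unfolding E_def space by blast
    note * = PiM_measure_mono_of_cells[where \<phi>="\<phi> k", OF \<mu> \<nu>(1,2) finite_lessThan \<phi>m fin this closed ratio]
    show "E k \<in> sets N" unfolding N_def by (rule *(1))
    show "L * measure N (E k)
        \<le> measure (Pi\<^sub>M {..<n} (\<lambda>_. \<nu>)) (E k)" unfolding N_def by (rule *(2))
  qed
  interpret P\<mu>: finite_product_prob_space "\<lambda>_. \<mu>" "{..<n}" by unfold_locales simp
  interpret P\<nu>: finite_product_prob_space "\<lambda>_. \<nu>" "{..<n}" by unfold_locales simp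
  have setsN: "sets (Pi\<^sub>M {..<n} (\<lambda>_. \<nu>)) = sets N"
    unfolding N_def by (rule sets_PiM_cong) (use \<nu>(2) in auto)
  show "?E \<in> sets N" unfolding EU using step(1) by auto
  \<comment> \<open>One tilted law serves all \<open>k\<close>, so the disjoint first-crossing
    events have total tilted probability at most 1.\<close>
  have "L * measure N ?E = (\<Sum>k\<le>m. L * measure N (E k))"
    unfolding EU sum_distrib_left[symmetric]
    by (subst P\<mu>.finite_measure_finite_Union[folded N_def]) (use disj step(1) in auto)
  also have "\<dots> \<le> (\<Sum>k\<le>m. measure (Pi\<^sub>M {..<n} (\<lambda>_. \<nu>)) (E k))"
    using step(2) by (intro sum_mono) auto
  also have "\<dots> = measure (Pi\<^sub>M {..<n} (\<lambda>_. \<nu>)) (\<Union>k\<in>{..m}. E k)"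
    by (subst P\<nu>.finite_measure_finite_Union) (use disj step(1) setsN in auto)
  also have "\<dots> \<le> 1" by simp
  finally show "L * measure N ?E \<le> 1" .
qed

subsection \<open>One-sided deviations of the empirical distribution function\<close>

text \<open>Moving factors from the smaller base to the larger one increases the product. This
  reduces counts beyond a crossing boundary to the count on it.\<close>

lemma power_mult_power_diff_mono:
  fixes a b :: real
  assumes "0 \<le> a" "a \<le> b" "c \<le> j" "j \<le> n"
  shows "a ^ j * b ^ (n - j) \<le> a ^ c * b ^ (n - c)"
proof -
  have "a ^ j * b ^ (n - j) = a ^ c * (a ^ (j - c) * b ^ (n - j))"
    using assms by (simp flip: power_add mult.assoc)
  also have "\<dots> \<le> a ^ c * (b ^ (j - c) * b ^ (n - j))"
    using assms by (intro mult_left_mono mult_right_mono power_mono) auto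
  also have "b ^ (j - c) * b ^ (n - j) = b ^ (n - c)"
    using assms by (simp flip: power_add)
  finally show ?thesis .
qed

lemma exp_le_powers:
  fixes a b e x :: real
  assumes "0 < a" "0 < b" "k \<le> n" "real k = real n * x" "e \<le> x * ln a + (1 - x) * ln b"
  shows "exp (real n * e) \<le> a ^ k * b ^ (n - k)"
proof -
  have nk: "real (n - k) = real n * (1 - x)" using assms by (simp add: of_nat_diff algebra_simps)
  have "exp (real n * e) \<le> exp (real n * (x * ln a + (1 - x) * ln b))"
    using assms by (simp add: mult_left_mono)
  also have "real n * (x * ln a + (1 - x) * ln b) = real k * ln a + real (n - k) * ln b"
    unfolding nk assms(4) by (simp add: algebra_simps)
  also have "exp (real k * ln a + real (n - k) * ln b) = a ^ k * b ^ (n - k)"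
    unfolding exp_add exp_of_nat_mult using assms by simp
  finally show ?thesis .
qed

lemma empirical_cdf_bounds: "0 \<le> empirical_cdf n z u" "empirical_cdf n z u \<le> 1"
proof -
  have "card {i. i < n \<and> z i \<le> u} \<le> card {..<n}" by (intro card_mono) auto
  then show "0 \<le> empirical_cdf n z u" "empirical_cdf n z u \<le> 1"
    by (auto simp: empirical_cdf_def divide_le_eq)
qed

lemma (in real_distribution) cdf_surj:
  assumes "continuous_on UNIV (cdf M)" "0 < t" "t < 1"
  shows "\<exists>x. cdf M x = t"
proof -
  have "eventually (\<lambda>x. cdf M x < t) at_bot"
    using cdf_lim_at_bot assms(2) by (rule order_tendstoD)
  then obtain a where a: "cdf M a < t" by (metis eventually_at_bot_linorder order_refl)
  have "eventually (\<lambda>x. t < cdf M x) at_top"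
    using cdf_lim_at_top_prob assms(3) by (rule order_tendstoD)
  then obtain b where b: "t < cdf M b" by (metis eventually_at_top_linorder order_refl)
  have "a \<le> b" using a b cdf_nondecreasing[of b a] by linarith
  then have "\<exists>x\<ge>a. x \<le> b \<and> cdf M x = t"
    using a b assms(1) by (intro IVT') (auto intro: continuous_on_subset)
  then show ?thesis by blast
qed

text \<open>
  A crossing \<open>cdf M u + l
      < empirical_cdf n z u\<close> with \<open>k\<close> points up to \<open>u\<close> persists at the quantile
  of level \<open>t k = k / n - l\<close>.  The levels up to \<open>(1
      - l) / 2\<close> are scanned from the left and the others
  from the right; each scan contributes \<open>exp (- 2 * n * l\<^sup>2)\<close>.
\<close>

lemma (in real_distribution) dkw_one_sided:
  fixes l :: real and n :: nat
  assumes cont: "continuous_on UNIV (cdf M)" and l0: "0 < l"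
  defines "N \<equiv> Pi\<^sub>M {..<n} (\<lambda>_. M)"
  shows "measure N {z \<in> space N. \<exists>u. cdf M u + l < empirical_cdf n z u}
      \<le> 2 * exp (- 2 * real n * l\<^sup>2)"
proof (cases "l < 1 \<and> 0 < n")
  \<comment> \<open>If \<open>l\<close> is at least 1, no empirical CDF exceeds it; if
    \<open>n = 0\<close>, the empirical CDF is identically 0, being a quotient by zero.\<close>
  case False
  then have "{z \<in> space N. \<exists>u. cdf M u + l < empirical_cdf n z u} = {}"
    using l0 empirical_cdf_bounds(2)[of n] cdf_nonneg
    by (auto simp: not_less) (smt (verit), smt (verit) empirical_cdf_def divide_eq_0_iff of_nat_0)
  then show ?thesis by (simp del: Collect_empty_eq)
next
  case True
  then have l1: "l < 1" and n: "0 < n" by auto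
  interpret N: finite_product_prob_space "\<lambda>_. M" "{..<n}" by unfold_locales simp
  define s where "s = (1 - l) / 2"
  define t where "t k = real k / real n - l" for k
  \<comment> \<open>Continuity provides a quantile when \<open>0 < t k\<close> and
    \<open>k \<le> n\<close>; elsewhere the choice may be arbitrary, and \<open>EL\<close> and
    \<open>ER\<close> exclude those indices.\<close>
  define x where "x k = (SOME x. cdf M x = t k)" for k
  define cnt where "cnt k z = card {i. i < n \<and> z i \<le> x k}" for k and z :: "nat \<Rightarrow> real"
  have t_mono: "t j < t k \<longleftrightarrow> j < k" "t j \<le> t k \<longleftrightarrow> j \<le> k" for j k
    using n by (auto simp: t_def divide_less_cancel divide_le_cancel)
  have t1: "t k < 1" if "k \<le> n" for k
  proof -
    have "real k / real n \<le> 1" using that n by simp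
    then show ?thesis using l0 by (simp add: t_def)
  qed
  have x: "cdf M (x k) = t k" if "0 < t k" "k \<le> n" for k
    unfolding x_def by (rule someI_ex) (use cdf_surj[OF cont] that t1 in blast)
  have x_mono: "x j \<le> x k" if "0 < t j" "j \<le> k" "k \<le> n" for j k
  proof (cases "j = k")
    case False
    then have "cdf M (x j) < cdf M (x k)"
      using that t_mono(1)[of j k] x[of j] x[of k] by simp
    then show ?thesis using cdf_nondecreasing[of "x k" "x j"] by linarith
  qed simp
  define L where "L = exp (real n * (2 * l\<^sup>2))"
  define EL where "EL = {z \<in> space N. \<exists>k\<le>n. 0 < t k \<and> t k \<le> s \<and> k \<le> cnt k z}"
  define ER where "ER = {z \<in> space N. \<exists>k\<le>n. s < t k \<and> k \<le> cnt k z}"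
  have sub: "{z \<in> space N. \<exists>u. cdf M u + l < empirical_cdf n z u} \<subseteq> EL \<union> ER"
  proof safe
    fix z u assume z: "z \<in> space N" "cdf M u + l < empirical_cdf n z u" "z \<notin> ER"
    define k where "k = card {i. i < n \<and> z i \<le> u}"
    have kn: "k \<le> n"
    proof -
      have "k \<le> card {..<n}" unfolding k_def by (intro card_mono) auto
      then show ?thesis by simp
    qed
    have Fu: "cdf M u < t k" using z(2) by (simp add: empirical_cdf_def t_def k_def)
    then have tk: "0 < t k" using cdf_nonneg[of u] by linarith
    then have "u \<le> x k" using Fu x[OF tk kn] cdf_nondecreasing[of "x k" u] by linarith
    then have "k \<le> cnt k z" unfolding k_def cnt_def by (intro card_mono) auto
    moreover have "t k \<le> s" using z calculation kn unfolding ER_def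
        by (metis (mono_tags, lifting) mem_Collect_eq not_le)
    ultimately show "z \<in> EL" using z tk kn unfolding EL_def by blast
  qed
  have EL: "EL \<in> sets N" "L * measure N EL \<le> 1"
  proof -
    define K where "K = {k. k \<le> n \<and> 0 < t k \<and> t k \<le> s}"
    have "EL \<in> sets N \<and> L * measure N EL \<le> 1"
    proof (cases "K = {}")
      case True
      then have "EL = {}" by (auto simp: EL_def K_def)
      then show ?thesis by simp
    next
      case False
      have finK: "finite K" by (simp add: K_def)
      \<comment> \<open>\<open>K\<close> is an interval of indices because \<open>t\<close> is
        increasing, so a shift by \<open>k0\<close> gives a chain indexed from 0 to
        \<open>m\<close>.\<close>
      define k0 m where "k0 = Min K" and "m = Max K - k0"
      have k0: "k0 \<in> K" and k1: "Max K \<in> K" using False finK by (auto simp: k0_def)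
      have k01: "k0 + m = Max K" using Max_ge[OF finK k0] by (simp add: m_def)
      have inK: "k0 + j \<in> K" if "j \<le> m" for j
      proof -
        have "k0 \<le> k0 + j" "k0 + j \<le> Max K" using that k01 by auto
        then show ?thesis using k0 k1 t_mono(2)[of k0 "k0 + j"] t_mono(2)[of "k0 + j" "Max K"]
          unfolding K_def by auto
      qed
      define g where "g = (1 + l) / (1 - l)"
      have g: "1 < g" using l0 l1 by (simp add: g_def field_simps)
      have gs: "g * s = (1 + l) / 2" using l1 by (simp add: g_def s_def field_simps)
      have gt: "g * t k < 1" if "k \<in> K" for k
      proof -
        have "g * t k \<le> g * s" using that g by (intro mult_left_mono) (auto simp: K_def)
        then show ?thesis using gs l1 by simp
      qed
      have A: "measure M {..x (k0 + j)} = t (k0 + j)" if "j \<le> m" for j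
        using x inK[OF that] by (auto simp: K_def cdf_def)
      have W: "L \<le> g ^ c * ((1 - g * measure M {..x (k0 + j)}) / (1 - measure M {..x (k0 + j)})) ^ (n - c)"
        if j: "j \<le> m" "c \<le> n" "c \<in> {k0 + j..}" for j c
      proof -
        let ?k = "k0 + j" let ?r = "(1 - g * t ?k) / (1 - t ?k)"
        have k: "?k \<le> n" "0 < t ?k" "t ?k \<le> s" using inK[OF j(1)] by (auto simp: K_def)
        have t1': "t ?k < 1" using t1 k by simp
        have "t ?k \<le> g * t ?k" using k g by simp
        then have r: "0 < ?r" "?r \<le> 1" using t1' gt[OF inK[OF j(1)]] by auto
        have "L \<le> g ^ ?k * ?r ^ (n - ?k)"
          unfolding L_def
        proof (rule exp_le_powers)
          show "real ?k = real n * (t ?k + l)" using n by (simp add: t_def)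
          show "2 * l\<^sup>2 \<le> (t ?k + l) * ln g + (1 - (t ?k + l)) * ln ?r"
            using left_exponent_bound[OF l0 l1, of "t ?k" g] k by (simp add: s_def g_def diff_diff_eq)
        qed (use g r k in auto)
        \<comment> \<open>Counts above the boundary only raise the likelihood ratio since
          \<open>?r \<le> 1 < g\<close>; the two bases change roles in the monotonicity
          lemma.\<close>
        also have "\<dots> \<le> g ^ c * ?r ^ (n - c)"
          using power_mult_power_diff_mono[of ?r g "n - c" "n - ?k" n] r g j k by (simp add: mult.commute)
        finally show ?thesis unfolding A[OF j(1)] .
      qed
      have "EL = {z \<in> space N. \<exists>j\<le>m. card {i. i < n \<and> z i \<in> {..x (k0
          + j)}} \<in> {k0 + j..}}"
      proof (intro set_eqI iffI)
        fix z assume "z \<in> EL"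
        then obtain k where k: "z \<in> space N" "k \<in> K" "k \<le> cnt k z" by (auto simp: EL_def K_def)
        then have "k0 \<le> k" "k \<le> k0 + m" using finK
            by (auto simp: k0_def[symmetric] k01 intro: Min_le Max_ge) (auto simp: k0_def)
        then show "z \<in> {z \<in> space N. \<exists>j\<le>m. card {i. i
            < n \<and> z i \<in> {..x (k0 + j)}} \<in> {k0 + j..}}"
          using k by (auto simp: cnt_def intro!: exI[of _ "k - k0"])
      next
        fix z assume "z \<in> {z \<in> space N. \<exists>j\<le>m. card {i. i
            < n \<and> z i \<in> {..x (k0 + j)}} \<in> {k0 + j..}}"
        then obtain j where "z \<in> space N" "j \<le> m" "k0 + j \<le> cnt (k0 + j) z" by (auto simp: cnt_def)
        then show "z \<in> EL" using inK[of j] unfolding EL_def K_def by blast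
      qed
      moreover have "g * measure M {..x (k0 + m)} \<le> 1" using A[of m] gt[OF inK[of m]] by simp
      moreover have "measure M {..x (k0 + m)} < 1" using A[of m] t1 inK[of m] by (simp add: K_def)
      moreover have "{..x (k0 + i)} \<subseteq> {..x (k0 + j)}" if "i \<le> j" "j \<le> m" for i j
        using x_mono[of "k0 + i" "k0 + j"] inK[of i] inK[of j] that by (auto simp: K_def)
      ultimately show ?thesis
        using chain_crossing_bound[of M m "\<lambda>j. {..x (k0 + j)}" g n "\<lambda>j. {k0 + j..}" L] W g
        unfolding N_def by (simp add: prob_space_axioms)
    qed
    then show "EL \<in> sets N" "L * measure N EL \<le> 1" by auto
  qed
  have ER: "ER \<in> sets N" "L * measure N ER \<le> 1"
  proof -
    define K where "K = {k. k \<le> n \<and> s < t k}"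
    have s0: "0 < s" using l1 by (simp add: s_def)
    have "ER \<in> sets N \<and> L * measure N ER \<le> 1"
    proof (cases "K = {}")
      case True
      then have "ER = {}" by (auto simp: ER_def K_def)
      then show ?thesis by simp
    next
      case False
      have finK: "finite K" by (simp add: K_def)
      \<comment> \<open>Scanning from the right, index \<open>j\<close> stands for the half-line
        above the quantile of level \<open>t (n - j)\<close>. A crossing there means that at most
        \<open>j\<close> points lie in it, hence the sets \<open>{..j}\<close>.\<close>
      define m where "m = n - Min K"
      have k0: "Min K \<in> K" using False finK by auto
      have inK: "n - j \<in> K" if "j \<le> m" for j
      proof -
        have "Min K \<le> n" using k0 by (simp add: K_def)
        then have "Min K \<le> n - j" using that by (simp add: m_def)
        then show ?thesis using k0 t_mono(2)[of "Min K" "n - j"] by (auto simp: K_def)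
      qed
      have mn: "m \<le> n" by (simp add: m_def)
      have tn: "t (n - j) = 1 - (real j / real n + l)" if "j \<le> m" for j
        using that mn n by (simp add: t_def of_nat_diff diff_divide_distrib)
      have s_eq: "1 - s = (1 + l) / 2" by (simp add: s_def field_simps)
      have sig: "l \<le> real j / real n + l" "real j / real n + l < (1 + l) / 2" if "j \<le> m" for j
      proof -
        have "s < t (n - j)" using inK[OF that] by (simp add: K_def)
        then show "real j / real n + l < (1 + l) / 2" using tn[OF that] s_eq by linarith
      qed simp
      obtain g where g: "0 < g" "g < 1" "\<And>v. l \<le> v \<Longrightarrow> v \<le> (1
          + l) / 2 \<Longrightarrow>
          2 * l\<^sup>2 \<le> (v - l) * ln g + (1 - v + l) * ln ((1 - g * v) / (1 - v))"
        using right_exponent_bound[OF l0 l1] by blast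
      have A: "measure M {x (n - j)<..} = real j / real n + l" if j: "j \<le> m" for j
      proof -
        have "{x (n - j)<..} = space M - {..x (n - j)}" by auto
        then have "measure M {x (n - j)<..} = 1 - cdf M (x (n - j))"
          by (simp add: cdf_def prob_compl del: space_eq_univ)
        then show ?thesis using x[of "n - j"] inK[OF j] s0 tn[OF j] by (simp add: K_def)
      qed
      have W: "L \<le> g ^ c * ((1 - g * measure M {x (n - j)<..}) / (1 - measure M {x (n - j)<..})) ^ (n - c)"
        if j: "j \<le> m" "c \<le> n" "c \<in> {..j}" for j c
      proof -
        let ?v = "real j / real n + l" let ?r = "(1 - g * ?v) / (1 - ?v)"
        have v: "0 < ?v" using sig(1)[OF j(1)] l0 by linarith
        have v': "?v < 1" by (rule less_trans[OF sig(2)[OF j(1)]]) (use l1 in simp)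
        then have "g * ?v \<le> 1 * ?v" using g less_imp_le[OF v] by (intro mult_right_mono) simp_all
        then have r: "1 \<le> ?r" using v' by simp
        have "L \<le> g ^ j * ?r ^ (n - j)"
          unfolding L_def
        proof (rule exp_le_powers)
          show "real j = real n * (?v - l)" using n by simp
          show "2 * l\<^sup>2 \<le> (?v - l) * ln g + (1 - (?v - l)) * ln ?r"
            using g(3)[of ?v] sig[OF j(1)] by simp
        qed (use g r j mn in auto)
        also have "\<dots> \<le> g ^ c * ?r ^ (n - c)"
          using power_mult_power_diff_mono[of g ?r c j n] r g j mn by simp
        finally show ?thesis unfolding A[OF j(1)] .
      qed
      have count: "card {i. i < n \<and> z i \<in> {x k<..}} = n - cnt k z" for k
          and z :: "nat \<Rightarrow> real"
      proof -
        have eq: "{i. i < n \<and> z i \<in> {x k<..}} = {..<n} - {i. i < n \<and> z i \<le> x k}" by auto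
        have "card ({..<n} - {i. i < n \<and> z i \<le> x k}) = card {..<n} - cnt k z"
          unfolding cnt_def by (rule card_Diff_subset) auto
        then show ?thesis unfolding eq by simp
      qed
      have "ER = {z \<in> space N. \<exists>j\<le>m. card {i. i < n \<and> z i \<in> {x (n
          - j)<..}} \<in> {..j}}"
      proof (intro set_eqI iffI)
        fix z assume "z \<in> ER"
        then obtain k where k: "z \<in> space N" "k \<in> K" "k \<le> cnt k z" by (auto simp: ER_def K_def)
        then have "Min K \<le> k" "k \<le> n" using finK by (auto simp: K_def)
        then have "n - k \<le> m" "n - (n - k) = k" by (auto simp: m_def)
        moreover have "n - cnt k z \<in> {..n - k}" using k by auto
        ultimately show "z \<in> {z \<in> space N. \<exists>j\<le>m. card {i. i
            < n \<and> z i \<in> {x (n - j)<..}} \<in> {..j}}"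
          unfolding count using k(1) by auto
      next
        fix z assume "z \<in> {z \<in> space N. \<exists>j\<le>m. card {i. i
            < n \<and> z i \<in> {x (n - j)<..}} \<in> {..j}}"
        then obtain j where "z \<in> space N" "j \<le> m" "n - j \<le> cnt (n - j) z" unfolding count by auto
        then show "z \<in> ER" using inK[of j] unfolding ER_def K_def by blast
      qed
      moreover have "g * measure M {x (n - m)<..} \<le> 1"
        using mult_mono[of g 1 "measure M {x (n - m)<..}" 1] g by auto
      moreover have "measure M {x (n - m)<..} < 1" unfolding A[OF order_refl]
          by (rule less_trans[OF sig(2)[OF order_refl]]) (use l1 in simp)
      moreover have "{x (n - i)<..} \<subseteq> {x (n - j)<..}" if "i \<le> j" "j \<le> m" for i j
        using x_mono[of "n - j" "n - i"] inK[of j] s0 that by (auto simp: K_def)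
      ultimately show ?thesis
        using chain_crossing_bound[of M m "\<lambda>j. {x (n - j)<..}" g n "\<lambda>j. {..j}" L] W g(1)
        unfolding N_def by (simp add: prob_space_axioms)
    qed
    then show "ER \<in> sets N" "L * measure N ER \<le> 1" by auto
  qed
  have "measure N {z \<in> space N. \<exists>u. cdf M u + l < empirical_cdf n z u}
      \<le> measure N (EL \<union> ER)"
    unfolding N_def using sub EL(1) ER(1) by (intro N.finite_measure_mono) (auto simp: N_def)
  also have "\<dots> \<le> measure N EL + measure N ER"
    using EL(1) ER(1) by (rule measure_Un_le)
  also have "\<dots> \<le> 1 / L + 1 / L"
    using EL(2) ER(2) by (intro add_mono) (auto simp: L_def field_simps)
  also have "\<dots> = 2 * exp (- 2 * real n * l\<^sup>2)"
    by (simp add: L_def exp_minus field_simps)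
  finally show ?thesis .
qed

section \<open>Crossing events for independent samples\<close>

definition exceeds :: "(real \<Rightarrow> real) \<Rightarrow> real \<Rightarrow> nat \<Rightarrow> (nat \<Rightarrow> real) \<Rightarrow> bool" where
  "exceeds F l n z \<longleftrightarrow> (\<exists>u. F u + l < empirical_cdf n z u)"

lemma exceeds_cong:
  assumes "\<And>i. i < n \<Longrightarrow> z i = z' i"
  shows "exceeds F l n z \<longleftrightarrow> exceeds F l n z'"
proof -
  have "{i. i < n \<and> z i \<le> u} = {i. i < n \<and> z' i \<le> u}" for u using assms by auto
  then show ?thesis by (simp add: exceeds_def empirical_cdf_def)
qed

text \<open>Moving \<open>u\<close> down to the largest sample value not above it keeps the count
  and does not increase \<open>F\<close>; such a value exists because \<open>l\<close> is positive.
  The uncountable quantifier becomes a finite one, which gives measurability.\<close>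

lemma exceeds_at_sample:
  assumes F: "mono F" "\<And>u. 0 \<le> F u" and l: "0 < l"
  shows "exceeds F l n z \<longleftrightarrow> (\<exists>i<n. F (z i) + l < empirical_cdf n z (z i))"
proof
  assume "exceeds F l n z"
  then obtain u where u: "F u + l < empirical_cdf n z u" by (auto simp: exceeds_def)
  define S where "S = {i. i < n \<and> z i \<le> u}"
  have "0 < empirical_cdf n z u" using u F(2)[of u] l by linarith
  then have "S \<noteq> {}" unfolding empirical_cdf_def S_def[symmetric] by (intro notI) simp
  moreover have "finite S" by (simp add: S_def)
  ultimately have S: "finite S" "S \<noteq> {}" by auto
  then have "Max (z ` S) \<in> z ` S" by simp
  then obtain i where i: "i \<in> S" "z i = Max (z ` S)" by auto
  have "{j. j < n \<and> z j \<le> u} \<subseteq> {j. j < n \<and> z j \<le> z i}"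
    using S i(2) by (auto simp: S_def)
  then have "empirical_cdf n z u \<le> empirical_cdf n z (z i)"
    by (auto simp: empirical_cdf_def intro!: divide_right_mono card_mono)
  moreover have "F (z i) \<le> F u" using F(1) i by (auto simp: S_def mono_def)
  ultimately have "F (z i) + l < empirical_cdf n z (z i)" using u by linarith
  then show "\<exists>i<n. F (z i) + l < empirical_cdf n z (z i)" using i by (auto simp: S_def)
qed (auto simp: exceeds_def)

lemma empirical_cdf_eq_sum: "empirical_cdf n z u = (\<Sum>i<n. if z i \<le> u then 1 else 0) / real n"
proof -
  have "{..<n} \<inter> {i. z i \<le> u} = {i. i < n \<and> z i \<le> u}" by auto
  then show ?thesis by (simp add: empirical_cdf_def sum.If_cases)
qed

lemma borel_measurable_empirical_cdf:
  assumes "\<And>i. i < n \<Longrightarrow> (\<lambda>w. Z w i) \<in> borel_measurable M" "U \<in> borel_measurable M"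
  shows "(\<lambda>w. empirical_cdf n (Z w) (U w)) \<in> borel_measurable M"
proof -
  note [measurable] = assms
  have "(\<lambda>w. \<Sum>i<n. if Z w i \<le> U w then 1 else 0 :: real) \<in> borel_measurable M"
    by (intro borel_measurable_sum) measurable
  then show ?thesis unfolding empirical_cdf_eq_sum by measurable
qed

lemma sets_exceeds:
  assumes F: "mono F" "\<And>u. 0 \<le> F u" and l: "0 < l"
    and Z: "\<And>i. i < n \<Longrightarrow> (\<lambda>w. Z w i) \<in> borel_measurable M"
  shows "{w \<in> space M. exceeds F l n (Z w)} \<in> sets M"
proof -
  have [measurable]: "F \<in> borel_measurable borel" using F(1) by (rule borel_measurable_mono)
  note [measurable] = Z borel_measurable_empirical_cdf[of n Z M]
  have "{w \<in> space M. \<exists>i\<in>{..<n}. F (Z w i) + l < empirical_cdf n (Z w) (Z w i)} \<in> sets M"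
    by measurable
  then show ?thesis unfolding exceeds_at_sample[OF F l] by (simp add: Bex_def)
qed

text \<open>Independent variables with common law have the product measure as joint law, and the
  event depends only on the first \<open>n\<close> values, so the product-space bound
  transfers.\<close>

lemma (in prob_space) prob_exceeds:
  assumes Z: "indep_vars (\<lambda>_. borel) Z {..<n}" and d: "\<And>i. i < n
      \<Longrightarrow> distr M borel (Z i) = \<mu>"
    and \<mu>: "real_distribution \<mu>" "continuous_on UNIV (cdf \<mu>)" and l: "0 < l" and n: "0 < n"
  shows "prob {w \<in> space M. exceeds (cdf \<mu>) l n (\<lambda>i. Z i w)}
      \<le> 2 * exp (- 2 * real n * l\<^sup>2)"
proof -
  interpret \<mu>: real_distribution \<mu> by fact
  have rv: "Z i \<in> borel_measurable M" if "i \<in> {..<n}" for i using Z that by (auto simp: indep_vars_def)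
  have F: "mono (cdf \<mu>)" "\<And>u. 0 \<le> cdf \<mu> u"
      by (auto intro: monoI \<mu>.cdf_nondecreasing \<mu>.cdf_nonneg)
  define V where "V w = (\<lambda>i\<in>{..<n}. Z i w)" for w
  have "distr M (\<Pi>\<^sub>M i\<in>{..<n}. borel) V = (\<Pi>\<^sub>M i\<in>{..<n}. distr M borel (Z i))"
    unfolding V_def using n rv Z by (subst indep_vars_iff_distr_eq_PiM'[symmetric]) auto
  also have "\<dots> = (\<Pi>\<^sub>M i\<in>{..<n}. \<mu>)" using d by (intro PiM_cong) auto
  finally have law: "distr M (\<Pi>\<^sub>M i\<in>{..<n}. borel) V = (\<Pi>\<^sub>M i\<in>{..<n}. \<mu>)" .
  have V: "V \<in> measurable M (\<Pi>\<^sub>M i\<in>{..<n}. borel)"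
    unfolding V_def using rv by (intro measurable_restrict) auto
  let ?B = "{z \<in> space (\<Pi>\<^sub>M i\<in>{..<n}. (borel :: real measure)). exceeds (cdf \<mu>) l n z}"
  have B: "?B \<in> sets (\<Pi>\<^sub>M i\<in>{..<n}. borel)"
    by (rule sets_exceeds[OF F l]) auto
  have "{w \<in> space M. exceeds (cdf \<mu>) l n (\<lambda>i. Z i w)} = V -` ?B \<inter> space M"
    using measurable_space[OF V] by (auto simp: V_def cong: exceeds_cong)
  then have "prob {w \<in> space M. exceeds (cdf \<mu>) l n (\<lambda>i. Z i w)}
      = measure (\<Pi>\<^sub>M i\<in>{..<n}. \<mu>) ?B"
    unfolding law[symmetric] by (simp add: measure_distr[OF V B])
  also have "?B = {z \<in> space (\<Pi>\<^sub>M i\<in>{..<n}. \<mu>). \<exists>u. cdf \<mu> u + l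
      < empirical_cdf n z u}"
    by (simp add: space_PiM exceeds_def)
  also have "measure (\<Pi>\<^sub>M i\<in>{..<n}. \<mu>) \<dots> \<le> 2 * exp (- 2 * real n * l\<^sup>2)"
    by (rule \<mu>.dkw_one_sided[OF \<mu>(2) l])
  finally show ?thesis .
qed

text \<open>Continuity excludes an atom at \<open>- t\<close>, so open and closed half-lines have
  the same mass.\<close>

lemma (in real_distribution) cdf_distr_uminus:
  assumes "continuous_on UNIV (cdf M)"
  shows "cdf (distr M borel uminus) t = 1 - cdf M (- t)"
proof -
  have "measure M {- t} = 0"
    using assms isCont_cdf[of "- t"] by (auto simp: continuous_on_eq_continuous_at)
  moreover have "{..- t} = {..<- t} \<union> {- t}" by auto
  ultimately have lt: "measure M {..- t} = measure M {..<- t}"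
    by (simp add: finite_measure_Union measure_zero_union del: Un_insert_right)
  have "uminus -` {..t} \<inter> space M = space M - {..<- t}" by auto
  then have "cdf (distr M borel uminus) t = measure M (space M - {..<- t})"
    by (simp add: cdf_def measure_distr del: space_eq_univ)
  also have "\<dots> = 1 - measure M {..<- t}" by (subst prob_compl) auto
  finally show ?thesis by (simp add: cdf_def lt)
qed

text \<open>Each point satisfies \<open>y i \<le> u\<close> or \<open>- y i \<le> - u\<close>, so
  the two empirical CDFs sum to at least 1. Shortfalls of a sample thus become excesses of the
  negated sample, and one one-sided bound serves for both.\<close>

lemma exceeds_uminus:
  assumes n: "0 < n" and u: "empirical_cdf n y u + l < F u"
  shows "exceeds (\<lambda>t. 1 - F (- t)) l n (\<lambda>i. - y i)"
proof -
  have "{..<n} \<subseteq> {i. i < n \<and> y i \<le> u} \<union> {i. i < n \<and> - y i \<le> - u}" by auto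
  then have "card {..<n} \<le> card {i. i < n \<and> y i \<le> u} + card {i. i < n \<and> - y i \<le> - u}"
    using card_mono[of "{i. i < n \<and> y i \<le> u} \<union> {i. i < n \<and> - y i \<le> - u}" "{..<n}"]
      card_Un_le[of "{i. i < n \<and> y i \<le> u}" "{i. i < n \<and> - y i \<le> - u}"] by simp
  then have "real n \<le> real (card {i. i < n \<and> y i \<le> u}) + real (card {i. i < n \<and>
      - y i \<le> - u})"
    by (simp flip: of_nat_add)
  then have "1 \<le> empirical_cdf n y u + empirical_cdf n (\<lambda>i. - y i) (- u)"
    using n by (simp add: empirical_cdf_def field_simps)
  then show ?thesis using u unfolding exceeds_def by (intro exI[of _ "- u"]) simp
qed

section \<open>From deviations to the detection rate\<close>

text \<open>Monotonicity of the alien CDF makes the bound at the maximal candidate equivalent to the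
  bound at all candidates. Without candidates the rate is 1, which suffices because
  \<open>\<eta>\<close> is nonnegative.\<close>

lemma alien_detection_rate_threshold:
  assumes Da: "prob_space Da" "score \<in> borel_measurable Da" and \<eta>: "0 \<le> \<eta>"
  shows "alien_detection_rate score Da (threshold q \<alpha>' n x y) \<ge> 1 - \<eta> \<longleftrightarrow>
    (\<forall>u \<in> x ` {..<n} \<union> y ` {..<n}. alien_cdf_estimate \<alpha>' n x y u
        \<le> q \<longrightarrow> score_cdf score Da u \<le> \<eta>)"
proof -
  interpret prob_space Da by fact
  interpret S: real_distribution "distr Da borel score" using Da(2) by (rule real_distribution_distr)
  define C where "C = {u \<in> x ` {..<n} \<union> y ` {..<n}. alien_cdf_estimate \<alpha>' n x y u \<le> q}"
  have "finite C" by (simp add: C_def)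
  have "alien_detection_rate score Da (threshold q \<alpha>' n x y) \<ge> 1
      - \<eta> \<longleftrightarrow> (\<forall>u\<in>C. score_cdf score Da u \<le> \<eta>)"
  proof (cases "C = {}")
    case True
    then have "threshold q \<alpha>' n x y = - \<infinity>" by (simp add: threshold_def C_def)
    then show ?thesis using True \<eta> by (simp add: alien_detection_rate_def prob_space)
  next
    case False
    then have "threshold q \<alpha>' n x y = ereal (Max C)" by (simp add: threshold_def C_def Let_def)
    then have "alien_detection_rate score Da (threshold q \<alpha>' n x y) = 1 - score_cdf score Da (Max C)"
      by (simp add: alien_detection_rate_real[OF Da])
    moreover have "score_cdf score Da u \<le> score_cdf score Da (Max C)" if "u \<in> C" for u
      unfolding score_cdf_def using that \<open>finite C\<close> by (intro S.cdf_nondecreasing) simp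
    moreover have "Max C \<in> C" using False \<open>finite C\<close> by simp
    ultimately show ?thesis by force
  qed
  then show ?thesis unfolding C_def by blast
qed

text \<open>Admissibility gives \<open>Fa \<le> F0\<close>, so replacing \<open>\<alpha>\<close> by
  \<open>\<alpha>'\<close> errs in the safe direction. The two samples then contribute errors
  \<open>l\<close> and \<open>(1 - \<alpha>') * l\<close>; their sum
  \<open>(2 - \<alpha>') * l\<close> is \<open>\<alpha>' * \<epsilon>\<close>, which dictates the
  choice of \<open>l\<close>.\<close>

lemma alien_cdf_le_of_no_crossing:
  fixes F0 Fa Fm :: real
  assumes \<alpha>: "0 < \<alpha>" "\<alpha> \<le> \<alpha>'" "\<alpha>' \<le> 1" and mix: "Fm = (1
      - \<alpha>) * F0 + \<alpha> * Fa" and adm: "Fm \<le> F0"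
    and l: "l = \<epsilon> * \<alpha>' / (2 - \<alpha>')" and est: "(Em - (1
        - \<alpha>') * E0) / \<alpha>' \<le> q"
    and E: "E0 \<le> F0 + l" "Fm \<le> Em + l"
  shows "Fa \<le> q + \<epsilon>"
proof -
  have "\<alpha> * Fa \<le> \<alpha> * F0" using mix adm by (simp add: algebra_simps)
  then have "Fa \<le> F0" using \<alpha> by simp
  then have "(\<alpha>' - \<alpha>) * Fa \<le> (\<alpha>' - \<alpha>) * F0" using \<alpha>
      by (intro mult_left_mono) auto
  then have "\<alpha>' * Fa \<le> Fm - (1 - \<alpha>') * F0" unfolding mix by (simp add: algebra_simps)
  also have "\<dots> \<le> Em + l - (1 - \<alpha>') * (E0 - l)"
    using E \<alpha> by (intro diff_mono mult_left_mono) auto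
  also have "\<dots> = (Em - (1 - \<alpha>') * E0) + (2 - \<alpha>') * l" by (simp add: algebra_simps)
  also have "(2 - \<alpha>') * l = \<alpha>' * \<epsilon>" using \<alpha> by (simp add: l)
  also have "Em - (1 - \<alpha>') * E0 \<le> \<alpha>' * q" using est \<alpha>
      by (simp add: divide_le_eq mult.commute)
  finally have "\<alpha>' * Fa \<le> \<alpha>' * (q + \<epsilon>)" by (simp add: algebra_simps)
  then show ?thesis using \<alpha> by simp
qed

lemma two_exp_le_of_sample_size:
  fixes \<gamma> l :: real
  assumes "0 < \<gamma>" "0 < l" "real n > 1 / 2 * ln (2 / \<gamma>) / l\<^sup>2"
  shows "2 * exp (- 2 * real n * l\<^sup>2) \<le> \<gamma>"
proof -
  have "1 / 2 * ln (2 / \<gamma>) < real n * l\<^sup>2" using assms by (simp add: pos_divide_less_eq)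
  then have "ln (2 / \<gamma>) \<le> 2 * real n * l\<^sup>2" by simp
  then have "exp (ln (2 / \<gamma>)) \<le> exp (2 * real n * l\<^sup>2)" by (simp only: exp_le_cancel_iff)
  then have "2 / \<gamma> \<le> exp (2 * real n * l\<^sup>2)" using assms(1) by simp
  then have "2 \<le> \<gamma> * exp (2 * real n * l\<^sup>2)" using assms(1)
      by (simp add: pos_divide_le_eq mult.commute)
  then have "2 / exp (2 * real n * l\<^sup>2) \<le> \<gamma>" by (simp add: pos_divide_le_eq)
  then have "2 * exp (- (2 * real n * l\<^sup>2)) \<le> \<gamma>" unfolding exp_minus divide_inverse .
  then show ?thesis by (simp only: mult_minus_left)
qed

theorem corollary1:
  fixes D0 Da Dm :: "'a measure" and score :: "'a \<Rightarrow> real"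
    and M :: "'w measure" and X Y :: "nat \<Rightarrow> 'w \<Rightarrow> 'a"
    and \<alpha> \<alpha>' q \<epsilon> \<delta> \<eta> :: real and n :: nat
  assumes "prob_space D0" and "prob_space Da" and "sets Da = sets D0"
    and "score \<in> borel_measurable D0"
    and "0 < \<alpha>" and "\<alpha> \<le> \<alpha>'" and "\<alpha>' \<le> 1"
    and "Dm = mixture \<alpha> Da D0"
    and "continuous_on UNIV (score_cdf score D0)"
    and "continuous_on UNIV (score_cdf score Da)"
    and "prob_space M"
    and "prob_space.indep_vars M (case_sum (\<lambda>_. D0) (\<lambda>_. Dm)) (case_sum X Y)
           ({..<n} <+> {..<n})"
    and "\<And>i. i < n \<Longrightarrow> distr M D0 (X i) = D0"
    and "\<And>i. i < n \<Longrightarrow> distr M Dm (Y i) = Dm"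
    and "0 < q" and "q < 1"
    and "0 < \<epsilon>" and "\<epsilon> < 1 - q"
    and "0 < \<delta>" and "\<delta> < 1"
    and "\<eta> = q + \<epsilon>"
    and "admissible score D0 Dm"
    and "real n > 1 / 2 * ln (2 / (1 - sqrt (1 - \<delta>))) * (1 / \<epsilon>)^2 * ((2 - \<alpha>') / \<alpha>')^2"
  shows "measure M {\<omega> \<in> space M.
           alien_detection_rate score Da
             (threshold q \<alpha>' n (\<lambda>i. score (X i \<omega>)) (\<lambda>i. score (Y i \<omega>))) \<ge> 1 - \<eta>}
         \<ge> 1 - \<delta>"
proof -
  interpret D0: prob_space D0 by fact
  interpret Da: prob_space Da by fact
  interpret prob_space M by fact
  have Dm: "prob_space Dm" "sets Dm = sets D0"
    unfolding assms(8) using prob_space_mixture[OF assms(2,1,3)] sets_mixture[OF assms(2,1,3)] by simp_all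
  interpret Dm: prob_space Dm by fact
  have sa: "score \<in> borel_measurable Da" and sm: "score \<in> borel_measurable Dm"
    using assms(4) by (simp_all cong: measurable_cong_sets add: assms(3) Dm(2))
  have mix: "score_cdf score Dm t = (1 - \<alpha>) * score_cdf score D0 t + \<alpha> * score_cdf score Da t" for t
    unfolding assms(8) by (rule score_cdf_mixture[OF assms(2,1,3) _ _ assms(4)]) (use assms(5-7) in auto)
  define l where "l = \<epsilon> * \<alpha>' / (2 - \<alpha>')"
  define \<gamma> where "\<gamma> = 1 - sqrt (1 - \<delta>)"
  have \<alpha>': "0 < \<alpha>'" "0 < 2 - \<alpha>'" using assms by auto
  have l: "0 < l" using \<alpha>' assms by (simp add: l_def)
  have \<gamma>: "0 < \<gamma>" "\<gamma> \<le> 1" using assms by (auto simp: \<gamma>_def)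
  have size: "real n > 1 / 2 * ln (2 / \<gamma>) / l\<^sup>2"
    using assms(23) \<alpha>' assms(17) by (simp add: \<gamma>_def l_def power_divide power_mult_distrib divide_simps mult_ac)
  \<comment> \<open>The size condition forces \<open>n\<close> to be positive, because
    \<open>2 / \<gamma>\<close> is at least 2.\<close>
  have "0 < ln (2 / \<gamma>)" using \<gamma> by (simp add: ln_gt_zero)
  then have "0 < 1 / 2 * ln (2 / \<gamma>) / l\<^sup>2" using l by (intro divide_pos_pos mult_pos_pos) auto
  then have "0 < real n" using size by (rule less_trans)
  then have n: "0 < n" by simp

  define \<mu>0 where "\<mu>0 = distr D0 borel score"
  define \<mu>m where "\<mu>m = distr Dm borel score"
  define \<mu>1 where "\<mu>1 = distr \<mu>m borel uminus"
  interpret \<mu>0: real_distribution \<mu>0 unfolding \<mu>0_def by (rule D0.real_distribution_distr) fact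
  interpret \<mu>m: real_distribution \<mu>m unfolding \<mu>m_def by (rule Dm.real_distribution_distr) fact
  interpret \<mu>1: real_distribution \<mu>1 unfolding \<mu>1_def by (rule \<mu>m.real_distribution_distr) simp
  have F0: "cdf \<mu>0 = score_cdf score D0" and Fm: "cdf \<mu>m = score_cdf score Dm"
    by (simp_all add: score_cdf_def \<mu>0_def \<mu>m_def)
  have contm: "continuous_on UNIV (cdf \<mu>m)"
    unfolding Fm mix[abs_def] using assms(9,10) by (intro continuous_intros)
  have F1: "cdf \<mu>1 = (\<lambda>t. 1 - score_cdf score Dm (- t))"
    unfolding \<mu>1_def \<mu>m.cdf_distr_uminus[OF contm, abs_def] Fm ..
  have cont1: "continuous_on UNIV (cdf \<mu>1)"
    unfolding F1 Fm[symmetric] by (intro continuous_intros continuous_on_compose2[OF contm]) auto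

  \<comment> \<open>The mixture scores are negated because their empirical CDF must be bounded from
    below.\<close>
  define Z where "Z = case_sum (\<lambda>i w. score (X i w)) (\<lambda>i w. - score (Y i w))"
  have indep: "indep_vars (\<lambda>_. borel) Z ({..<n} <+> {..<n})"
  proof -
    let ?f = "case_sum (\<lambda>_::nat. score) (\<lambda>_::nat. \<lambda>x. - score x)"
    have "indep_vars (\<lambda>_. borel) (\<lambda>i w. ?f i (case_sum X Y i w)) ({..<n} <+> {..<n})"
      by (rule indep_vars_compose2[OF assms(12)]) (use assms(4) sm in \<open>auto split: sum.split\<close>)
    moreover have "(\<lambda>i w. ?f i (case_sum X Y i w)) = Z"
      by (auto simp: Z_def fun_eq_iff split: sum.split)
    ultimately show ?thesis by simp
  qed
  have Xm: "X i \<in> measurable M D0" "Y i \<in> measurable M Dm" if "i < n" for i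
    using assms(12) that unfolding indep_vars_def by force+
  have lawX: "distr M borel (\<lambda>w. score (X i w)) = \<mu>0" if "i < n" for i
  proof -
    have "distr M borel (\<lambda>w. score (X i w)) = distr (distr M D0 (X i)) borel score"
      using Xm(1)[OF that] assms(4) by (simp add: distr_distr comp_def)
    then show ?thesis using assms(13)[OF that] by (simp add: \<mu>0_def)
  qed
  have lawY: "distr M borel (\<lambda>w. - score (Y i w)) = \<mu>1" if "i < n" for i
  proof -
    have "distr M borel (\<lambda>w. - score (Y i w)) = distr (distr (distr M Dm (Y i)) borel score) borel uminus"
      using Xm(2)[OF that] sm by (simp add: distr_distr comp_def)
    then show ?thesis using assms(14)[OF that] by (simp add: \<mu>1_def \<mu>m_def)
  qed
  have indepX: "indep_vars (\<lambda>_. borel) (\<lambda>i w. score (X i w)) {..<n}"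
  proof -
    \<comment> \<open>Singleton blocks \<open>{Inl j}\<close> turn part of the joint family into one
      indexed by \<open>j\<close> itself.\<close>
    have "indep_vars (\<lambda>j. Pi\<^sub>M {Inl j} (\<lambda>_. borel)) (\<lambda>j w. \<lambda>i\<in>{Inl j}. Z i w) {..<n}"
      by (rule indep_vars_restrict[OF indep]) (auto simp: disjoint_family_on_def)
    from indep_vars_compose2[OF this, of "\<lambda>j f. f (Inl j)" "\<lambda>_. borel"]
    show ?thesis by (simp add: Z_def)
  qed
  have indepY: "indep_vars (\<lambda>_. borel) (\<lambda>i w. - score (Y i w)) {..<n}"
  proof -
    have "indep_vars (\<lambda>j. Pi\<^sub>M {Inr j} (\<lambda>_. borel)) (\<lambda>j w. \<lambda>i\<in>{Inr j}. Z i w) {..<n}"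
      by (rule indep_vars_restrict[OF indep]) (auto simp: disjoint_family_on_def)
    from indep_vars_compose2[OF this, of "\<lambda>j f. f (Inr j)" "\<lambda>_. borel"]
    show ?thesis by (simp add: Z_def)
  qed

  define GX where "GX = {w \<in> space M. \<not> exceeds (cdf \<mu>0) l n (\<lambda>i. score (X i w))}"
  define GY where "GY = {w \<in> space M. \<not> exceeds (cdf \<mu>1) l n (\<lambda>i. - score (Y i w))}"
  have mono0: "mono (cdf \<mu>0)" "\<And>u. 0 \<le> cdf \<mu>0 u" and mono1: "mono (cdf \<mu>1)" "\<And>u. 0 \<le> cdf \<mu>1 u"
    by (auto intro: monoI \<mu>0.cdf_nondecreasing \<mu>0.cdf_nonneg \<mu>1.cdf_nondecreasing \<mu>1.cdf_nonneg)
  have rvX: "(\<lambda>w. score (X i w)) \<in> borel_measurable M" and rvY: "(\<lambda>w. score (Y i w)) \<in> borel_measurable M" if "i < n" for i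
    using Xm[OF that] assms(4) sm by (auto intro: measurable_compose)
  have pX: "sqrt (1 - \<delta>) \<le> prob GX"
  proof -
    have "{w \<in> space M. exceeds (cdf \<mu>0) l n (\<lambda>i. score (X i w))} \<in> events"
      by (rule sets_exceeds[OF mono0 l rvX])
    then have "prob GX = 1 - prob {w \<in> space M. exceeds (cdf \<mu>0) l n (\<lambda>i. score (X i w))}"
      unfolding GX_def by (rule prob_neg)
    then show ?thesis
      using prob_exceeds[OF indepX lawX \<mu>0.real_distribution_axioms assms(9)[folded F0] l n] two_exp_le_of_sample_size[OF \<gamma>(1) l size]
      by (simp add: \<gamma>_def)
  qed
  have pY: "sqrt (1 - \<delta>) \<le> prob GY"
  proof -
    have "{w \<in> space M. exceeds (cdf \<mu>1) l n (\<lambda>i. - score (Y i w))} \<in> events"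
      by (rule sets_exceeds[OF mono1 l]) (use rvY in auto)
    then have "prob GY = 1 - prob {w \<in> space M. exceeds (cdf \<mu>1) l n (\<lambda>i. - score (Y i w))}"
      unfolding GY_def by (rule prob_neg)
    then show ?thesis
      using prob_exceeds[OF indepY lawY \<mu>1.real_distribution_axioms cont1 l n] two_exp_le_of_sample_size[OF \<gamma>(1) l size]
      by (simp add: \<gamma>_def)
  qed
  \<comment> \<open>The two halves of the sum type give independent random vectors, and each good
    event depends on one of them only.\<close>
  have prod: "prob (GX \<inter> GY) = prob GX * prob GY"
  proof -
    let ?A = "Inl ` {..<n} :: (nat + nat) set" and ?B = "Inr ` {..<n} :: (nat + nat) set"
    let ?PA = "Pi\<^sub>M ?A (\<lambda>_. borel :: real measure)" and ?PB = "Pi\<^sub>M ?B (\<lambda>_. borel :: real measure)"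
    let ?VA = "\<lambda>w. \<lambda>i\<in>?A. Z i w" and ?VB = "\<lambda>w. \<lambda>i\<in>?B. Z i w"
    have iv: "indep_var ?PA ?VA ?PB ?VB"
      by (rule indep_var_restrict[OF indep]) auto
    define SA where "SA = {f \<in> space ?PA. \<not> exceeds (cdf \<mu>0) l n (\<lambda>i. f (Inl i))}"
    define SB where "SB = {f \<in> space ?PB. \<not> exceeds (cdf \<mu>1) l n (\<lambda>i. f (Inr i))}"
    have "{f \<in> space ?PA. exceeds (cdf \<mu>0) l n (\<lambda>i. f (Inl i))} \<in> sets ?PA"
      by (rule sets_exceeds[OF mono0 l]) auto
    then have SA: "SA \<in> sets ?PA" unfolding SA_def by (rule sets.sets_Collect_neg)
    have "{f \<in> space ?PB. exceeds (cdf \<mu>1) l n (\<lambda>i. f (Inr i))} \<in> sets ?PB"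
      by (rule sets_exceeds[OF mono1 l]) auto
    then have SB: "SB \<in> sets ?PB" unfolding SB_def by (rule sets.sets_Collect_neg)
    have "GX = ?VA -` SA \<inter> space M"
      by (auto simp: GX_def SA_def space_PiM Z_def cong: exceeds_cong)
    moreover have "GY = ?VB -` SB \<inter> space M"
      by (auto simp: GY_def SB_def space_PiM Z_def cong: exceeds_cong)
    moreover have "(\<lambda>w. (?VA w, ?VB w)) -` (SA \<times> SB) \<inter> space M = (?VA -` SA \<inter> space M) \<inter> (?VB -` SB \<inter> space M)"
      by blast
    ultimately show ?thesis
      using indep_varD[OF iv SA SB] by simp
  qed

  let ?T = "{\<omega> \<in> space M. alien_detection_rate score Da
             (threshold q \<alpha>' n (\<lambda>i. score (X i \<omega>)) (\<lambda>i. score (Y i \<omega>))) \<ge> 1 - \<eta>}"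
  have \<eta>: "0 \<le> \<eta>" using assms by simp
  note rate = alien_detection_rate_threshold[OF assms(2) sa \<eta>]
  \<comment> \<open>Rewritten through \<open>rate\<close>, the event is a finite conjunction over
    the observed scores.\<close>
  have T: "?T \<in> events"
  proof -
    interpret Sa: real_distribution "distr Da borel score" using sa by (rule Da.real_distribution_distr)
    have [measurable]: "score_cdf score Da \<in> borel_measurable borel"
      by (rule borel_measurable_mono) (auto intro: monoI Sa.cdf_nondecreasing simp: score_cdf_def)
    have est: "(\<lambda>w. alien_cdf_estimate \<alpha>' n (\<lambda>i. score (X i w)) (\<lambda>i. score (Y i w)) (U w)) \<in> borel_measurable M"
      if "U \<in> borel_measurable M" for U
      unfolding alien_cdf_estimate_def
      by (intro borel_measurable_divide borel_measurable_diff borel_measurable_times borel_measurable_const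
          borel_measurable_empirical_cdf that rvX rvY)
    note [measurable] = rvX rvY est
    have "{w \<in> space M. (\<forall>j\<in>{..<n}. alien_cdf_estimate \<alpha>' n (\<lambda>i. score (X i w)) (\<lambda>i. score (Y i w)) (score (X j w)) \<le> q
            \<longrightarrow> score_cdf score Da (score (X j w)) \<le> \<eta>) \<and>
         (\<forall>j\<in>{..<n}. alien_cdf_estimate \<alpha>' n (\<lambda>i. score (X i w)) (\<lambda>i. score (Y i w)) (score (Y j w)) \<le> q
            \<longrightarrow> score_cdf score Da (score (Y j w)) \<le> \<eta>)} \<in> events"
      by measurable
    then show ?thesis unfolding rate by (simp add: ball_Un)
  qed
  have sub: "GX \<inter> GY \<subseteq> ?T"
  proof
    fix w assume w: "w \<in> GX \<inter> GY"
    have "score_cdf score Da u \<le> \<eta>"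
      if "alien_cdf_estimate \<alpha>' n (\<lambda>i. score (X i w)) (\<lambda>i. score (Y i w)) u \<le> q" for u
      unfolding assms(21)
    proof (rule alien_cdf_le_of_no_crossing[OF assms(5-7) mix _ l_def that[unfolded alien_cdf_estimate_def]])
      show "score_cdf score Dm u \<le> score_cdf score D0 u" using assms(22) by (simp add: admissible_def)
      show "empirical_cdf n (\<lambda>i. score (X i w)) u \<le> score_cdf score D0 u + l"
        using w by (auto simp: GX_def exceeds_def F0 not_less)
      show "score_cdf score Dm u \<le> empirical_cdf n (\<lambda>i. score (Y i w)) u + l"
        using w exceeds_uminus[OF n, of "\<lambda>i. score (Y i w)" u l "score_cdf score Dm"]
        by (force simp: GY_def F1 not_less)
    qed
    then show "w \<in> ?T" using w unfolding rate by (auto simp: GX_def)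
  qed
  \<comment> \<open>Each sample is good with probability at least \<open>sqrt (1 - \<delta>)\<close>
    and independence multiplies the two bounds; hence the term
    \<open>1 - sqrt (1 - \<delta>)\<close> in the sample size.\<close>
  have "1 - \<delta> = sqrt (1 - \<delta>) * sqrt (1 - \<delta>)" using assms by simp
  also have "\<dots> \<le> prob GX * prob GY" using pX pY assms by (intro mult_mono) auto
  also have "\<dots> = prob (GX \<inter> GY)" using prod by simp
  also have "\<dots> \<le> prob ?T" using sub T by (rule finite_measure_mono)
  finally show ?thesis .
qed

end
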